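(* Let $n\ge 2$, $k>0$, and let $\mathbb{S}^n(1/k)\subset\mathbb{R}^{n+1}$ be the round sphere of radius $1/k$ with Levi-Civita connection $\nabla$. Then the infimum of \[ F(X)=\frac{\int_{\mathbb{S}^n(1/k)}\|\nabla X\|^2}{\int_{\mathbb{S}^n(1/k)}\|X\|^2} \] over nonzero $X\in C^\infty(T\mathbb{S}^n(1/k))$ equals $k^2$, and it is attained by the orthogonal projection onto $T\mathbb{S}^n(1/k)$ of a constant nonzero vector field of $\mathbb{R}^{n+1}$. Moreover, a (nonzero) Killing field of $\mathbb{S}^n(1/k)$ realizes the infimum $k^2$ if and only if $n=2$. *)

theory Defs
  imports "HOL-Analysis.Analysis"
begin

text \<open>Ambient space: a Euclidean space 'a of dimension n+1 (n = DIM('a) - 1).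
  The round sphere of radius 1/k is the library set sphere 0 (1/k).\<close>

fun Cdiff :: "nat \<Rightarrow> 'a::euclidean_space set \<Rightarrow> ('a \<Rightarrow> 'b::euclidean_space) \<Rightarrow> bool" where
  "Cdiff 0 U f = continuous_on U f"
| "Cdiff (Suc m) U f = (f differentiable_on U \<and>
      (\<forall>v\<in>Basis. Cdiff m U (\<lambda>x. frechet_derivative f (at x) v)))"

definition smooth_on :: "'a::euclidean_space set \<Rightarrow> ('a \<Rightarrow> 'b::euclidean_space) \<Rightarrow> bool" where
  "smooth_on U f \<longleftrightarrow> (\<forall>m. Cdiff m U f)"

definition tangent_space :: "'a::euclidean_space \<Rightarrow> 'a set" where
  "tangent_space p = {v. v \<bullet> p = 0}"

definition tproj :: "'a::euclidean_space \<Rightarrow> 'a \<Rightarrow> 'a" where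
  "tproj p v = v - ((v \<bullet> p) / (p \<bullet> p)) *\<^sub>R p"

definition smooth_tangent_field :: "real \<Rightarrow> ('a::euclidean_space \<Rightarrow> 'a) \<Rightarrow> bool" where
  "smooth_tangent_field r X \<longleftrightarrow>
     (\<exists>U. open U \<and> sphere 0 r \<subseteq> U \<and> smooth_on U X) \<and>
     (\<forall>p\<in>sphere 0 r. X p \<in> tangent_space p)"

text \<open>Levi-Civita connection of the sphere as a submanifold of Euclidean space:
  tangential part of the ambient directional derivative.\<close>
definition nabla :: "('a::euclidean_space \<Rightarrow> 'a) \<Rightarrow> 'a \<Rightarrow> 'a \<Rightarrow> 'a" where
  "nabla X p v = tproj p (frechet_derivative X (at p) v)"

definition orthonormal_basis_of :: "'a::euclidean_space set \<Rightarrow> 'a set \<Rightarrow> bool" where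
  "orthonormal_basis_of B T \<longleftrightarrow> finite B \<and> B \<subseteq> T \<and> span B = T \<and>
     (\<forall>e\<in>B. norm e = 1) \<and> pairwise orthogonal B"

definition nabla_norm2 :: "('a::euclidean_space \<Rightarrow> 'a) \<Rightarrow> 'a \<Rightarrow> real" where
  "nabla_norm2 X p =
     (let B = (SOME B. orthonormal_basis_of B (tangent_space p))
      in \<Sum>e\<in>B. (norm (nabla X p e))\<^sup>2)"

text \<open>Integral over the sphere of radius r with respect to the Riemannian (surface)
  measure, defined via the cone measure: for the unit sphere S in a space of dimension
  d, sigma(A) = d * lebesgue(cone over A); scaling to radius r gives the factor r^(d-1).\<close>
definition sphere_integral :: "real \<Rightarrow> ('a::euclidean_space \<Rightarrow> real) \<Rightarrow> real" where
  "sphere_integral r f =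
     r ^ (DIM('a) - 1) * real DIM('a) *
       (LINT x|lborel. indicator (ball (0::'a) 1) x * f (r *\<^sub>R (x /\<^sub>R norm x)))"

definition rayleigh :: "real \<Rightarrow> ('a::euclidean_space \<Rightarrow> 'a) \<Rightarrow> real" where
  "rayleigh r X = sphere_integral r (nabla_norm2 X) / sphere_integral r (\<lambda>p. (norm (X p))\<^sup>2)"

definition killing_field :: "real \<Rightarrow> ('a::euclidean_space \<Rightarrow> 'a) \<Rightarrow> bool" where
  "killing_field r X \<longleftrightarrow> smooth_tangent_field r X \<and>
     (\<forall>p\<in>sphere 0 r. \<forall>v\<in>tangent_space p. \<forall>w\<in>tangent_space p.
        nabla X p v \<bullet> w + nabla X p w \<bullet> v = 0)"

end

theory Submission
  imports Defs
begin

text \<open>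
  Write \<open>r = 1/k\<close>, let \<open>n\<close> be the dimension of the sphere, and let \<open>A = \<nabla>X\<close>, an endomorphism of each
  tangent space. The divergence theorem applied to the tangential part of \<open>(tr A) X - D\<^sub>X X\<close> gives
  the Bochner-type identity
  \<open>r\<^sup>2 \<integral> ((tr A)\<^sup>2 - tr A\<^sup>2) = (n - 1) \<integral> |X|\<^sup>2\<close>.
  Pointwise, Cauchy-Schwarz on the diagonal of the symmetric part of \<open>A\<close> gives
  \<open>(tr A)\<^sup>2 - tr A\<^sup>2 \<le> (n - 1) |A|\<^sup>2\<close> for \<open>n \<ge> 2\<close>, so the Rayleigh quotient is at least \<open>k\<^sup>2\<close>.
  For the projection of a constant field, \<open>A\<close> is a multiple of the identity and equality holds.
  For a Killing field, \<open>A\<close> is skew, the left-hand side equals \<open>|A|\<^sup>2\<close>, and the quotient is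
  \<open>(n - 1) k\<^sup>2\<close>.

  The divergence theorem comes from symmetry: the cone measure is rotation invariant, so the
  derivative of any function along an infinitesimal rotation integrates to zero, and a tangential
  divergence is a combination of such derivatives.
\<close>

subsection \<open>Rotation invariance of Lebesgue measure\<close>

text \<open>On every line parallel to \<open>i\<close> the function \<open>h\<close> is constant, so
  the map acts there as a translation; Fubini in the direction \<open>i\<close> reduces the claim to
  translation invariance on the real line.\<close>

lemma distr_lborel_shear:
  fixes h :: "'a::euclidean_space \<Rightarrow> real"
  assumes [measurable]: "h \<in> borel_measurable borel"
    and i: "i \<in> Basis" and inv: "\<And>x s. h (x + s *\<^sub>R i) = h x"
  shows "distr lborel borel (\<lambda>x. x + h x *\<^sub>R i) = lborel"
proof (rule measure_eqI)
  fix A :: "'a set" assume "A \<in> sets (distr lborel borel (\<lambda>x. x + h x *\<^sub>R i))"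
  then have [measurable]: "A \<in> sets borel" by simp
  interpret product_sigma_finite "\<lambda>_::'a. lborel :: real measure" ..
  define I where "I = Basis - {i}"
  define v where "v f = (\<Sum>b\<in>Basis. f b *\<^sub>R b)" for f :: "'a \<Rightarrow> real"
  have I: "finite I" "i \<notin> I" "Basis = insert i I" using i by (auto simp: I_def)
  have v[measurable]: "v \<in> (\<Pi>\<^sub>M b\<in>Basis. lborel) \<rightarrow>\<^sub>M borel"
    unfolding v_def by measurable
  \<comment> \<open>The coordinate along \<open>i\<close> is integrated innermost, and
    \<open>f(i := 0)\<close> gives the base point of the line on which the other coordinates are
    fixed.\<close>
  have fubini: "(\<integral>\<^sup>+x. g x \<partial>lborel) =
      (\<integral>\<^sup>+f. (\<integral>\<^sup>+y. g (v (f(i := 0)) + y *\<^sub>R i) \<partial>lborel) \<partial>(\<Pi>\<^sub>M b\<in>I. lborel))"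
    if [measurable]: "g \<in> borel_measurable borel" for g
  proof -
    have "(\<integral>\<^sup>+x. g x \<partial>lborel) = (\<integral>\<^sup>+f. g (v f) \<partial>(\<Pi>\<^sub>M b\<in>Basis. lborel))"
      by (subst lborel_eq) (simp add: nn_integral_distr v_def[symmetric])
    also have "\<dots> = (\<integral>\<^sup>+f. (\<integral>\<^sup>+y. g (v (f(i := y))) \<partial>lborel) \<partial>(\<Pi>\<^sub>M b\<in>I. lborel))"
      unfolding I(3)
      by (rule product_nn_integral_insert[OF I(1,2)]) (simp add: I(3)[symmetric])
    also have "(\<lambda>f. \<integral>\<^sup>+y. g (v (f(i := y))) \<partial>lborel) = (\<lambda>f. \<integral>\<^sup>+y. g (v (f(i := 0)) + y *\<^sub>R i) \<partial>lborel)"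
    proof -
      have upd: "(\<Sum>b\<in>I. (f(i := z)) b *\<^sub>R b) = (\<Sum>b\<in>I. f b *\<^sub>R b)" for f :: "'a \<Rightarrow> real" and z
        using I(2) by (intro sum.cong) auto
      have eq: "v (f(i := y)) = v (f(i := 0)) + y *\<^sub>R i" for f y
        unfolding v_def I(3) sum.insert[OF I(1,2)] upd by simp
      show ?thesis by (intro ext nn_integral_cong arg_cong[where f=g] eq)
    qed
    finally show ?thesis .
  qed
  have "emeasure (distr lborel borel (\<lambda>x. x + h x *\<^sub>R i)) A =
      (\<integral>\<^sup>+x. indicator A x \<partial>distr lborel borel (\<lambda>x. x + h x *\<^sub>R i))"
    by simp
  also have "\<dots> = (\<integral>\<^sup>+x. indicator A (x + h x *\<^sub>R i) \<partial>lborel)"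
    by (rule nn_integral_distr) measurable
  also have "\<dots> = (\<integral>\<^sup>+f. (\<integral>\<^sup>+y. indicator A (v (f(i := 0)) + y *\<^sub>R i + h (v (f(i := 0)) + y *\<^sub>R i) *\<^sub>R i) \<partial>lborel)
      \<partial>(\<Pi>\<^sub>M b\<in>I. lborel))"
    by (rule fubini) measurable
  \<comment> \<open>The factor \<open>1 * y\<close> puts the integrand into the affine shape of
    \<open>nn_integral_real_affine\<close>, with slope 1 and offset \<open>h\<close> of the base
    point.\<close>
  also have "\<dots> = (\<integral>\<^sup>+f. (\<integral>\<^sup>+y. indicator A (v (f(i := 0)) + (h (v (f(i := 0))) + 1 * y) *\<^sub>R i) \<partial>lborel)
      \<partial>(\<Pi>\<^sub>M b\<in>I. lborel))"
    unfolding inv by (simp add: algebra_simps)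
  also have "\<dots> = (\<integral>\<^sup>+f. (\<integral>\<^sup>+y. indicator A (v (f(i := 0)) + y *\<^sub>R i) \<partial>lborel) \<partial>(\<Pi>\<^sub>M b\<in>I. lborel))"
  proof (rule nn_integral_cong)
    fix f :: "'a \<Rightarrow> real"
    let ?w = "v (f(i := 0))"
    show "(\<integral>\<^sup>+y. indicator A (?w + (h ?w + 1 * y) *\<^sub>R i) \<partial>lborel) =
        (\<integral>\<^sup>+y. indicator A (?w + y *\<^sub>R i) \<partial>lborel)"
      using nn_integral_real_affine[of "\<lambda>y. indicator A (?w + y *\<^sub>R i)" 1 "h ?w"] by simp
  qed
  also have "\<dots> = (\<integral>\<^sup>+x. indicator A x \<partial>lborel)"
    by (subst fubini) simp_all
  finally show "emeasure (distr lborel borel (\<lambda>x. x + h x *\<^sub>R i)) A = emeasure lborel A"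
    by simp
qed simp

text \<open>Written as the identity plus a correction in the span of \<open>i\<close> and
  \<open>j\<close>, so that no coordinates on the orthogonal complement are needed.\<close>

definition plane_rotation :: "'a::euclidean_space \<Rightarrow> 'a \<Rightarrow> real \<Rightarrow> 'a \<Rightarrow> 'a" where
  "plane_rotation i j t x = x + ((cos t - 1) * (x \<bullet> i) - sin t * (x \<bullet> j)) *\<^sub>R i
     + ((cos t - 1) * (x \<bullet> j) + sin t * (x \<bullet> i)) *\<^sub>R j"

text \<open>A rotation by an angle other than \<open>\<pi>\<close> is a product of three shears.\<close>

lemma distr_lborel_plane_rotation:
  fixes i j :: "'a::euclidean_space"
  assumes ij: "i \<in> Basis" "j \<in> Basis" "i \<noteq> j" and t: "cos t \<noteq> -1"
  shows "distr lborel borel (plane_rotation i j t) = lborel"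
proof -
  \<comment> \<open>This is tan (t/2), the slope of the two outer shears; the excluded angle is the
    one where the denominator vanishes.\<close>
  define u where "u = sin t / (1 + cos t)"
  define S where "S = (\<lambda>x::'a. x + (- u * (x \<bullet> j)) *\<^sub>R i)"
  define T where "T = (\<lambda>x::'a. x + (sin t * (x \<bullet> i)) *\<^sub>R j)"
  have o: "i \<bullet> j = 0" "j \<bullet> i = 0" "i \<bullet> i = 1" "j \<bullet> j = 1"
    using ij by (auto simp: inner_Basis)
  have [measurable]: "S \<in> borel_measurable borel" "T \<in> borel_measurable borel"
    unfolding S_def T_def by measurable
  have S: "distr lborel borel S = lborel" unfolding S_def
    using ij o by (intro distr_lborel_shear) (auto simp: inner_simps)
  have T: "distr lborel borel T = lborel" unfolding T_def
    using ij o by (intro distr_lborel_shear) (auto simp: inner_simps)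
  have c: "1 + cos t \<noteq> 0" using t by auto
  have u1: "u * (1 + cos t) = sin t" using c by (simp add: u_def)
  have "(1 - sin t * u) * (1 + cos t) = (1 + cos t) - sin t * (u * (1 + cos t))"
    by algebra
  also have "\<dots> = cos t * (1 + cos t)"
    unfolding u1 using sin_cos_squared_add[of t] by algebra
  finally have u2: "1 - sin t * u = cos t" using c by simp
  have "plane_rotation i j t x = S (T (S x))" for x
  proof -
    define a b where "a = x \<bullet> i" and "b = x \<bullet> j"
    have Sx: "S x = x + (- u * b) *\<^sub>R i" by (simp add: S_def b_def)
    have TSx: "T (S x) = x + (- u * b) *\<^sub>R i + (sin t * (a - u * b)) *\<^sub>R j"
      unfolding Sx by (simp add: T_def inner_simps o a_def)
    have "S (T (S x)) = x + (- u * b - u * (b + sin t * (a - u * b))) *\<^sub>R i + (sin t * (a - u * b)) *\<^sub>R j"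
    proof -
      have "T (S x) \<bullet> j = b + sin t * (a - u * b)"
        unfolding TSx by (simp add: inner_simps o b_def)
      then have "S (T (S x)) = T (S x) + (- u * (b + sin t * (a - u * b))) *\<^sub>R i"
        by (simp add: S_def)
      then show ?thesis unfolding TSx by (simp add: scaleR_left.diff)
    qed
    \<comment> \<open>Both coefficients are expressed through \<open>1 - sin t * u\<close>, which
      \<open>u2\<close> then replaces by \<open>cos t\<close>.\<close>
    moreover have "- u * b - u * (b + sin t * (a - u * b)) =
        ((1 - sin t * u) - 1) * a - (u + u * (1 - sin t * u)) * b"
      by (simp add: algebra_simps)
    moreover have "u + u * cos t = sin t" using u1 by (simp add: distrib_left)
    moreover have "sin t * (a - u * b) = ((1 - sin t * u) - 1) * b + sin t * a"
      by (simp add: algebra_simps)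
    ultimately show ?thesis by (simp only: plane_rotation_def a_def b_def u2)
  qed
  then have eq: "plane_rotation i j t = S \<circ> (T \<circ> S)" by auto
  have "distr lborel borel (S \<circ> (T \<circ> S)) = distr (distr (distr lborel borel S) borel T) borel S"
    by (simp add: distr_distr comp_assoc)
  then show ?thesis unfolding eq by (simp add: S T)
qed

lemma norm_plane_rotation:
  assumes ij: "i \<in> Basis" "j \<in> Basis" "i \<noteq> j"
  shows "norm (plane_rotation i j t x) = norm x"
proof -
  define a b where ab: "a = x \<bullet> i" "b = x \<bullet> j"
  have o: "i \<bullet> j = 0" "j \<bullet> i = 0" "i \<bullet> i = 1" "j \<bullet> j = 1"
    using ij by (auto simp: inner_Basis)
  let ?p = "(cos t - 1) * a - sin t * b" and ?q = "(cos t - 1) * b + sin t * a"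
  have "plane_rotation i j t x \<bullet> plane_rotation i j t x = x \<bullet> x + (2 * ?p * a + 2 * ?q * b + ?p^2 + ?q^2)"
    unfolding plane_rotation_def ab[symmetric]
    by (simp add: inner_simps o inner_commute[of i x] inner_commute[of j x] ab[symmetric] power2_eq_square algebra_simps)
  also have "2 * ?p * a + 2 * ?q * b + ?p^2 + ?q^2 = 0"
    using sin_cos_squared_add[of t] by algebra
  finally show ?thesis by (simp add: norm_eq_sqrt_inner)
qed

lemma plane_rotation_scaleR: "plane_rotation i j t (c *\<^sub>R x) = c *\<^sub>R plane_rotation i j t x"
  by (simp add: plane_rotation_def inner_simps algebra_simps)

lemma borel_measurable_plane_rotation [measurable]: "plane_rotation i j t \<in> borel_measurable borel"
  unfolding plane_rotation_def[abs_def] by measurable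

lemma plane_rotation_0 [simp]: "plane_rotation i j 0 x = x"
  by (simp add: plane_rotation_def)

subsection \<open>Integration over spheres\<close>

lemma continuous_on_sphere_bounded:
  fixes f :: "'a::euclidean_space \<Rightarrow> real"
  assumes "continuous_on (sphere 0 r) f"
  obtains B where "\<And>x. x \<in> sphere 0 r \<Longrightarrow> \<bar>f x\<bar> \<le> B"
proof -
  have "bounded (f ` sphere 0 r)"
    using assms by (intro compact_imp_bounded compact_continuous_image) auto
  then have "\<exists>B. \<forall>x\<in>sphere 0 r. \<bar>f x\<bar> \<le> B" unfolding bounded_iff by simp
  then show ?thesis using that by blast
qed

lemma normalized_in_sphere:
  "r > 0 \<Longrightarrow> x \<noteq> 0 \<Longrightarrow> r *\<^sub>R (x /\<^sub>R norm x) \<in> sphere 0 r"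
  by simp

lemma continuous_on_cone:
  fixes f :: "'a::euclidean_space \<Rightarrow> real"
  assumes r: "r > 0" and f: "continuous_on (sphere 0 r) f"
  shows "continuous_on (- {0}) (\<lambda>x. f (r *\<^sub>R (x /\<^sub>R norm x)))"
proof (rule continuous_on_compose2[OF f])
  show "continuous_on (- {0}) (\<lambda>x::'a. r *\<^sub>R (x /\<^sub>R norm x))"
    by (intro continuous_intros) auto
  show "(\<lambda>x::'a. r *\<^sub>R (x /\<^sub>R norm x)) ` (- {0}) \<subseteq> sphere 0 r"
    using normalized_in_sphere[OF r] by blast
qed

text \<open>The degree-0 homogeneous extension of \<open>f\<close> is bounded, and it is continuous
  away from the origin, which is enough for measurability.\<close>

lemma integrable_cone:
  fixes f :: "'a::euclidean_space \<Rightarrow> real"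
  assumes r: "r > 0" and f: "continuous_on (sphere 0 r) f"
  shows "integrable lborel (\<lambda>x. indicator (ball 0 1) x * f (r *\<^sub>R (x /\<^sub>R norm x)))"
proof -
  obtain B where B: "\<And>x. x \<in> sphere 0 r \<Longrightarrow> \<bar>f x\<bar> \<le> B"
    using continuous_on_sphere_bounded[OF f] by blast
  have "continuous_on (- {0}) (\<lambda>x::'a. f (r *\<^sub>R (x /\<^sub>R norm x)))"
    by (rule continuous_on_cone[OF r f])
  then have "(\<lambda>x. indicator (- {0}) x *\<^sub>R f (r *\<^sub>R (x /\<^sub>R norm x))) \<in> borel_measurable borel"
    by (intro borel_measurable_continuous_on_indicator) auto
  \<comment> \<open>Division by zero makes the normalised vector 0 at the origin, so the extension
    takes the value \<open>f 0\<close> there. Continuity on the sphere says nothing about this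
    value, so it is added as a separate term.\<close>
  then have m1: "(\<lambda>x. indicator (- {0}) x *\<^sub>R f (r *\<^sub>R (x /\<^sub>R norm x)) + indicator {0} x * f 0) \<in> borel_measurable borel"
    by measurable
  have eq: "(\<lambda>x. indicator (- {0}) x *\<^sub>R f (r *\<^sub>R (x /\<^sub>R norm x)) + indicator {0} x * f 0) = (\<lambda>x. f (r *\<^sub>R (x /\<^sub>R norm x)))"
    by (rule ext) (auto simp: indicator_def)
  define g where "g x = f (r *\<^sub>R (x /\<^sub>R norm x))" for x
  have [measurable]: "g \<in> borel_measurable borel"
    using m1 eq by (simp only: g_def[abs_def])
  have b: "\<bar>g x\<bar> \<le> max B \<bar>f 0\<bar>" for x
    unfolding g_def using B[OF normalized_in_sphere[OF r], of x] by (cases "x = 0") auto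
  have "integrable lborel (\<lambda>x. indicator (ball 0 1) x *\<^sub>R g x)"
    using b emeasure_bounded_finite[of "ball (0::'a) 1"]
    by (intro integrableI_bounded_set_indicator[where B="max B \<bar>f 0\<bar>"]) auto
  then show ?thesis by (simp only: g_def real_scaleR_def)
qed

text \<open>Off the origin the integrand only sees values on the sphere, and the origin is a null
  set.\<close>

lemma sphere_integral_cong:
  assumes "r > 0" and f: "continuous_on (sphere 0 r) f" and fg: "\<And>x. x \<in> sphere 0 r \<Longrightarrow> f x = g x"
  shows "sphere_integral r f = sphere_integral r g"
proof -
  have g: "continuous_on (sphere 0 r) g" using f fg continuous_on_cong[OF refl, of "sphere 0 r" f g] by auto
  have "(LINT x|lborel. indicator (ball 0 1) x * f (r *\<^sub>R (x /\<^sub>R norm x))) =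
    (LINT x|lborel. indicator (ball 0 1) x * g (r *\<^sub>R (x /\<^sub>R norm x)))"
  proof (rule integral_cong_AE)
    show "AE x in lborel. indicator (ball 0 1) x * f (r *\<^sub>R (x /\<^sub>R norm x)) =
        indicator (ball 0 1) x * g (r *\<^sub>R (x /\<^sub>R norm x))"
      using AE_lborel_singleton[of 0]
      by eventually_elim (use \<open>r > 0\<close> in \<open>auto simp: fg\<close>)
  qed (use integrable_cone[OF \<open>r > 0\<close> f] integrable_cone[OF \<open>r > 0\<close> g] in auto)
  then show ?thesis by (simp add: sphere_integral_def)
qed

lemma sphere_integral_0 [simp]: "sphere_integral r (\<lambda>x. 0) = 0"
  by (simp add: sphere_integral_def)

lemma sphere_integral_cmult: "sphere_integral r (\<lambda>x. c * f x) = c * sphere_integral r f"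
  by (simp add: sphere_integral_def mult.left_commute[of _ c])

lemma sphere_integral_add:
  assumes "r > 0" "continuous_on (sphere 0 r) f" "continuous_on (sphere 0 r) g"
  shows "sphere_integral r (\<lambda>x. f x + g x) = sphere_integral r f + sphere_integral r g"
  using integrable_cone[OF assms(1,2)] integrable_cone[OF assms(1,3)]
  by (simp add: sphere_integral_def distrib_left)

lemma sphere_integral_sum:
  assumes "r > 0" "finite I" "\<And>i. i \<in> I \<Longrightarrow> continuous_on (sphere 0 r) (f i)"
  shows "sphere_integral r (\<lambda>x. \<Sum>i\<in>I. f i x) = (\<Sum>i\<in>I. sphere_integral r (f i))"
  using assms(2,3) by (induction I) (auto simp: sphere_integral_add[OF \<open>r > 0\<close>] continuous_on_sum)

lemma sphere_integral_mono:
  assumes r: "r > 0" and f: "continuous_on (sphere 0 r) f" and g: "continuous_on (sphere 0 r) g"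
    and le: "\<And>x. x \<in> sphere 0 r \<Longrightarrow> f x \<le> g x"
  shows "sphere_integral r f \<le> sphere_integral r g"
proof -
  have "(LINT x|lborel. indicator (ball 0 1) x * f (r *\<^sub>R (x /\<^sub>R norm x))) \<le>
    (LINT x|lborel. indicator (ball 0 1) x * g (r *\<^sub>R (x /\<^sub>R norm x)))"
  proof (rule integral_mono_AE[OF integrable_cone[OF r f] integrable_cone[OF r g]])
    show "AE x in lborel. indicator (ball 0 1) x * f (r *\<^sub>R (x /\<^sub>R norm x)) \<le>
        indicator (ball 0 1) x * g (r *\<^sub>R (x /\<^sub>R norm x))"
      using AE_lborel_singleton[of 0]
      by eventually_elim (use r in \<open>auto simp: le indicator_def\<close>)
  qed
  then show ?thesis unfolding sphere_integral_def using r by (intro mult_left_mono) auto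
qed

text \<open>Positivity at \<open>p\<close> spreads by continuity to an open cone around the ray
  through \<open>p\<close>. If the integral vanished, the part of this cone in the unit ball would
  be negligible, yet it is open and nonempty.\<close>

lemma sphere_integral_pos:
  fixes f :: "'a::euclidean_space \<Rightarrow> real"
  assumes r: "r > 0" and f: "continuous_on (sphere 0 r) f"
    and ge: "\<And>x. x \<in> sphere 0 r \<Longrightarrow> f x \<ge> 0" and p: "p \<in> sphere 0 r" "f p > 0"
  shows "sphere_integral r f > 0"
proof -
  define g where "g x = indicator (ball 0 1) x * f (r *\<^sub>R (x /\<^sub>R norm x))" for x :: 'a
  have g: "integrable lborel g" using integrable_cone[OF r f] by (simp add: g_def[abs_def])
  have nn: "AE x in lborel. g x \<ge> 0" using AE_lborel_singleton[of 0]
    by eventually_elim (use r in \<open>auto simp: g_def ge\<close>)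
  have "integral\<^sup>L lborel g \<noteq> 0"
  proof
    assume "integral\<^sup>L lborel g = 0"
    then have ae: "AE x in lborel. g x = 0" using integral_nonneg_eq_0_iff_AE[OF g nn] by simp
    have c: "continuous_on (- {0}) (\<lambda>x::'a. f (r *\<^sub>R (x /\<^sub>R norm x)))"
      by (rule continuous_on_cone[OF r f])
    define V where "V = (- {0}) \<inter> (\<lambda>x::'a. f (r *\<^sub>R (x /\<^sub>R norm x))) -` {0<..}"
    have oV: "open (V \<inter> ball 0 1)"
      unfolding V_def by (intro open_Int[OF continuous_open_preimage[OF c] open_ball]) auto
    have "p \<noteq> 0" using p r by auto
    \<comment> \<open>The point on the ray through \<open>p\<close> with norm 1/2: inside the unit
      ball and away from the origin.\<close>
    have "p /\<^sub>R (2 * norm p) \<in> V \<inter> ball 0 1"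
      using p \<open>p \<noteq> 0\<close> r by (auto simp: V_def)
    have "emeasure lborel (V \<inter> ball 0 1) = 0"
    proof -
      have "AE x in lborel. x \<notin> V \<inter> ball 0 1"
        using ae by eventually_elim (auto simp: V_def g_def)
      moreover have "V \<inter> ball 0 1 \<in> sets lborel" using oV by auto
      ultimately show ?thesis by (subst (asm) AE_iff_measurable[where N="V \<inter> ball 0 1"]) auto
    qed
    then have "negligible (V \<inter> ball 0 1)" using oV
      by (simp add: negligible_iff_null_sets null_sets_completionI null_setsI)
    then show False using open_not_negligible[OF oV] \<open>p /\<^sub>R (2 * norm p) \<in> V \<inter> ball 0 1\<close> by blast
  qed
  moreover have "integral\<^sup>L lborel g \<ge> 0" using nn by (rule integral_nonneg_AE)
  ultimately have "integral\<^sup>L lborel g > 0" by simp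
  then show ?thesis using r unfolding sphere_integral_def g_def[abs_def]
    by (intro mult_pos_pos) auto
qed

section \<open>Infinitesimal rotations and the divergence theorem\<close>

text \<open>The vector \<open>(x \<bullet> i) *\<^sub>R j - (x \<bullet> j) *\<^sub>R i\<close> is
  the velocity at \<open>x\<close> of the rotation in the plane of \<open>i\<close> and
  \<open>j\<close>. Composing \<open>f\<close> with rotations keeps the integral fixed, so its
  difference quotients integrate to 0, and dominated convergence carries this over to the
  derivative.\<close>

lemma sphere_integral_rotation_derivative:
  fixes f :: "'a::euclidean_space \<Rightarrow> real"
  assumes r: "r > 0" and U: "sphere 0 r \<subseteq> U"
    and ij: "i \<in> Basis" "j \<in> Basis" "i \<noteq> j"
    and f: "\<And>x. x \<in> U \<Longrightarrow> (f has_derivative f' x) (at x)"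
    and c: "continuous_on (sphere 0 r) (\<lambda>x. f' x ((x \<bullet> i) *\<^sub>R j - (x \<bullet> j) *\<^sub>R i))"
  shows "sphere_integral r (\<lambda>x. f' x ((x \<bullet> i) *\<^sub>R j - (x \<bullet> j) *\<^sub>R i)) = 0"
proof -
  let ?R = "plane_rotation i j"
  define L where "L x = f' x ((x \<bullet> i) *\<^sub>R j - (x \<bullet> j) *\<^sub>R i)" for x
  have cL: "continuous_on (sphere 0 r) L" using c by (simp add: L_def[abs_def])
  have cf: "continuous_on (sphere 0 r) f"
    using U f by (intro continuous_at_imp_continuous_on) (blast intro: has_derivative_continuous)
  have o: "i \<bullet> j = 0" "j \<bullet> i = 0" "i \<bullet> i = 1" "j \<bullet> j = 1"
    using ij by (auto simp: inner_Basis)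
  obtain B where B: "\<And>x. x \<in> sphere 0 r \<Longrightarrow> \<bar>L x\<bar> \<le> B"
    using continuous_on_sphere_bounded[OF cL] by blast
  have RS: "?R t q \<in> sphere 0 r" if "q \<in> sphere 0 r" for q t
    using that by (simp add: norm_plane_rotation[OF ij])
  \<comment> \<open>The orbit through \<open>q\<close> has at time \<open>t\<close> the velocity of
    the same linear field at the moved point. The formula is needed at all \<open>t\<close>, since
    the mean value theorem below evaluates it at intermediate times.\<close>
  have der: "((\<lambda>t. f (?R t q)) has_real_derivative L (?R t q)) (at t)" if "q \<in> sphere 0 r" for q t
  proof -
    have "((\<lambda>t. ?R t q) has_derivative
        (\<lambda>s. s *\<^sub>R ((?R t q \<bullet> i) *\<^sub>R j - (?R t q \<bullet> j) *\<^sub>R i))) (at t)"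
      unfolding plane_rotation_def
      by (auto intro!: derivative_eq_intros simp: inner_simps o algebra_simps)
    moreover have "(f has_derivative f' (?R t q)) (at (?R t q))"
      using RS[OF that] U f by blast
    ultimately have "((\<lambda>t. f (?R t q)) has_derivative
        (\<lambda>s. f' (?R t q) (s *\<^sub>R ((?R t q \<bullet> i) *\<^sub>R j - (?R t q \<bullet> j) *\<^sub>R i)))) (at t)"
      by (rule has_derivative_compose)
    moreover have "linear (f' (?R t q))"
      using RS[OF that] U f has_derivative_linear by blast
    ultimately show ?thesis
      by (simp add: has_field_derivative_def linear_cmul L_def mult.commute[of _ "f' _ _"] mult_commute_abs)
  qed
  define s where "s n x = indicator (ball 0 1) x *
    (real (Suc n) * (f (?R (1 / real (Suc n)) (r *\<^sub>R (x /\<^sub>R norm x))) - f (r *\<^sub>R (x /\<^sub>R norm x))))" for n x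
  have cR: "continuous_on (sphere 0 r) (\<lambda>q. f (?R t q))" for t
    using RS by (intro continuous_on_compose2[OF cf])
      (auto simp: plane_rotation_def[abs_def] intro!: continuous_intros)
  note ints = integrable_cone[OF r cf] integrable_cone[OF r cR]
  have inv: "(LINT x|lborel. indicator (ball 0 1) x * f (?R t (r *\<^sub>R (x /\<^sub>R norm x))))
      = (LINT x|lborel. indicator (ball 0 1) x * f (r *\<^sub>R (x /\<^sub>R norm x)))" if "cos t \<noteq> -1" for t
  proof -
    have "(LINT x|lborel. indicator (ball 0 1) x * f (r *\<^sub>R (x /\<^sub>R norm x)))
       = (LINT x|distr lborel borel (?R t). indicator (ball 0 1) x * f (r *\<^sub>R (x /\<^sub>R norm x)))"
      by (simp add: distr_lborel_plane_rotation[OF ij that])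
    also have "\<dots> = (LINT x|lborel. indicator (ball 0 1) (?R t x) *
        f (r *\<^sub>R (?R t x /\<^sub>R norm (?R t x))))"
      using ints(1) by (subst integral_distr) auto
    also have "\<dots> = (LINT x|lborel. indicator (ball 0 1) x * f (?R t (r *\<^sub>R (x /\<^sub>R norm x))))"
      by (simp add: norm_plane_rotation[OF ij] plane_rotation_scaleR indicator_def)
    finally show ?thesis ..
  qed
  have s0: "integral\<^sup>L lborel (s n) = 0" for n
  proof -
    define h where "h = 1 / real (Suc n)"
    have "0 < h" "h \<le> 1" by (auto simp: h_def)
    \<comment> \<open>All step sizes are at most 1, below pi/2, so the angle excluded in the
      invariance lemma never occurs.\<close>
    then have "cos h > 0" using pi_gt3 by (intro cos_gt_zero) linarith+
    then have c: "cos h \<noteq> -1" by linarith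
    have "s n = (\<lambda>x. real (Suc n) * (indicator (ball 0 1) x * f (?R h (r *\<^sub>R (x /\<^sub>R norm x)))
        - indicator (ball 0 1) x * f (r *\<^sub>R (x /\<^sub>R norm x))))"
      unfolding s_def h_def by (rule ext) (simp only: right_diff_distrib mult.left_commute)
    then have "integral\<^sup>L lborel (s n) = real (Suc n) *
        ((LINT x|lborel. indicator (ball 0 1) x * f (?R h (r *\<^sub>R (x /\<^sub>R norm x))))
        - (LINT x|lborel. indicator (ball 0 1) x * f (r *\<^sub>R (x /\<^sub>R norm x))))"
      by (simp only: integral_mult_right_zero Bochner_Integration.integral_diff[OF ints(2)[of h] ints(1)])
    then show ?thesis unfolding inv[OF c] by simp
  qed
  have "(\<lambda>n. integral\<^sup>L lborel (s n)) \<longlonglongrightarrow> (LINT x|lborel. indicator (ball 0 1) x * L (r *\<^sub>R (x /\<^sub>R norm x)))"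
  proof (rule integral_dominated_convergence)
    show "integrable lborel (\<lambda>x. indicator (ball 0 1) x * (\<lambda>_. B) (r *\<^sub>R (x /\<^sub>R norm (x::'a))))"
      using r by (intro integrable_cone) auto
    show "(\<lambda>x. indicator (ball 0 1) x * L (r *\<^sub>R (x /\<^sub>R norm x))) \<in> borel_measurable lborel"
      using integrable_cone[OF r cL] by auto
    show "s n \<in> borel_measurable lborel" for n
    proof -
      have "continuous_on (sphere 0 r) (\<lambda>q. real (Suc n) * (f (?R (1 / real (Suc n)) q) - f q))"
        by (intro continuous_intros cR cf)
      from integrable_cone[OF r this] show ?thesis unfolding s_def[abs_def] by auto
    qed
    show "AE x in lborel. (\<lambda>n. s n x) \<longlonglongrightarrow> indicator (ball 0 1) x * L (r *\<^sub>R (x /\<^sub>R norm x))"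
      using AE_lborel_singleton[of 0]
    proof eventually_elim
      fix x :: 'a assume "x \<noteq> 0"
      then have q: "r *\<^sub>R (x /\<^sub>R norm x) \<in> sphere 0 r" (is "?q \<in> _")
        using normalized_in_sphere[OF r] by blast
      have "((\<lambda>t. (f (?R (0 + t) ?q) - f (?R 0 ?q)) / t) \<longlongrightarrow> L (?R 0 ?q)) (at 0)"
        using der[OF q, of 0] unfolding DERIV_def .
      moreover have "filterlim (\<lambda>n. 1 / real (Suc n)) (at 0) sequentially"
        unfolding filterlim_at using LIMSEQ_inverse_real_of_nat by (auto simp: inverse_eq_divide)
      ultimately have "(\<lambda>n. (f (?R (0 + 1 / real (Suc n)) ?q) - f (?R 0 ?q)) / (1 / real (Suc n))) \<longlonglongrightarrow> L (?R 0 ?q)"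
        by (rule filterlim_compose)
      then show "(\<lambda>n. s n x) \<longlonglongrightarrow> indicator (ball 0 1) x * L ?q"
        unfolding s_def by (intro tendsto_mult_left) (simp add: mult.commute)
    qed
    show "AE x in lborel. norm (s n x) \<le> indicator (ball 0 1) x * B" for n
      using AE_lborel_singleton[of 0]
    proof eventually_elim
      fix x :: 'a assume "x \<noteq> 0"
      then have q: "r *\<^sub>R (x /\<^sub>R norm x) \<in> sphere 0 r" (is "?q \<in> _")
        using normalized_in_sphere[OF r] by blast
      \<comment> \<open>The mean value theorem turns the difference quotient into a value of
        \<open>L\<close> on the sphere, hence the bound \<open>B\<close> uniformly in
        \<open>n\<close>.\<close>
      obtain z where z: "f (?R (1 / real (Suc n)) ?q) - f (?R 0 ?q) = (1 / real (Suc n) - 0) * L (?R z ?q)"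
        using MVT2[of 0 "1 / real (Suc n)" "\<lambda>t. f (?R t ?q)" "\<lambda>t. L (?R t ?q)"] der[OF q] by auto
      then have "real (Suc n) * (f (?R (1 / real (Suc n)) ?q) - f ?q) = L (?R z ?q)" by simp
      then have "s n x = indicator (ball 0 1) x * L (?R z ?q)" by (simp only: s_def)
      then show "norm (s n x) \<le> indicator (ball 0 1) x * B"
        using B[OF RS[OF q]] by (simp add: abs_mult mult_left_mono)
    qed
  qed
  then have "(LINT x|lborel. indicator (ball 0 1) x * L (r *\<^sub>R (x /\<^sub>R norm x))) = 0"
    unfolding s0 by (simp add: LIMSEQ_const_iff)
  then show ?thesis by (simp add: sphere_integral_def L_def)
qed

text \<open>The left integrand is r^2 times the trace of \<open>Y' x\<close> over the tangent space;
  the right side is the mean curvature contribution of the normal part of \<open>Y\<close>. The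
  identity is the sum over all pairs \<open>i\<close>, \<open>j\<close> of the rotation lemma for
  the functions \<open>(x \<bullet> j) * (Y x \<bullet> i)\<close>.\<close>

lemma sphere_divergence:
  fixes Y :: "'a::euclidean_space \<Rightarrow> 'a"
  assumes r: "r > 0" and U: "sphere 0 r \<subseteq> U"
    and Y: "\<And>x. x \<in> U \<Longrightarrow> (Y has_derivative Y' x) (at x)"
    and c: "\<And>v. continuous_on (sphere 0 r) (\<lambda>x. Y' x v)"
  shows "sphere_integral r (\<lambda>x. r\<^sup>2 * (\<Sum>b\<in>Basis. Y' x b \<bullet> b) - Y' x x \<bullet> x)
     = (real DIM('a) - 1) * sphere_integral r (\<lambda>x. Y x \<bullet> x)"
proof -
  \<comment> \<open>The derivative of \<open>(x \<bullet> j) * (Y x \<bullet> i)\<close> along the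
    rotation velocity, with \<open>Y' x\<close> already expanded by linearity so that only fixed
    directions occur and \<open>c\<close> gives continuity.\<close>
  define L where "L i j x = ((x \<bullet> i) *\<^sub>R j - (x \<bullet> j) *\<^sub>R i) \<bullet> j * (Y x \<bullet> i)
     + (x \<bullet> j) * (((x \<bullet> i) *\<^sub>R Y' x j - (x \<bullet> j) *\<^sub>R Y' x i) \<bullet> i)" for i j x
  have cY: "continuous_on (sphere 0 r) Y"
    using U Y by (intro continuous_at_imp_continuous_on) (blast intro: has_derivative_continuous)
  have lin: "linear (Y' x)" if "x \<in> sphere 0 r" for x
    using that U Y has_derivative_linear by blast
  have cL: "continuous_on (sphere 0 r) (L i j)" for i j
    unfolding L_def by (intro continuous_intros c cY)
  have L0: "sphere_integral r (L i j) = 0" if ij: "i \<in> Basis" "j \<in> Basis" for i j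
  proof (cases "i = j")
    case True
    then show ?thesis by (simp add: L_def[abs_def])
  next
    case False
    define f' where "f' x v = (v \<bullet> j) * (Y x \<bullet> i) + (x \<bullet> j) * (Y' x v \<bullet> i)" for x v
    have f: "((\<lambda>x. (x \<bullet> j) * (Y x \<bullet> i)) has_derivative f' x) (at x)" if "x \<in> U" for x
      unfolding f'_def by (auto intro!: derivative_eq_intros Y[OF that] simp: algebra_simps)
    have e: "L i j x = f' x ((x \<bullet> i) *\<^sub>R j - (x \<bullet> j) *\<^sub>R i)" if "x \<in> sphere 0 r" for x
      by (simp add: L_def f'_def linear_diff[OF lin[OF that]] linear_cmul[OF lin[OF that]])
    then have "continuous_on (sphere 0 r) (\<lambda>x. f' x ((x \<bullet> i) *\<^sub>R j - (x \<bullet> j) *\<^sub>R i))"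
      by (rule continuous_on_eq[OF cL])
    from sphere_integral_rotation_derivative[OF r U ij False f this]
    show ?thesis using sphere_integral_cong[OF r cL e] by simp
  qed
  have "sphere_integral r (\<lambda>x. \<Sum>i\<in>Basis. \<Sum>j\<in>Basis. L i j x) = 0"
    by (simp add: sphere_integral_sum[OF r] cL L0 continuous_on_sum)
  moreover have "sphere_integral r (\<lambda>x. \<Sum>i\<in>Basis. \<Sum>j\<in>Basis. L i j x) = 
     sphere_integral r (\<lambda>x. (real DIM('a) - 1) * (Y x \<bullet> x) + (-1) * (r\<^sup>2 * (\<Sum>b\<in>Basis. Y' x b \<bullet> b) - Y' x x \<bullet> x))"
  proof (rule sphere_integral_cong[OF r])
    show "continuous_on (sphere 0 r) (\<lambda>x. \<Sum>i\<in>Basis. \<Sum>j\<in>Basis. L i j x)"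
      by (intro continuous_on_sum cL)
    fix x :: 'a assume x: "x \<in> sphere 0 r"
    then have xx: "(\<Sum>j\<in>Basis. (x \<bullet> j) * (x \<bullet> j)) = r\<^sup>2"
      by (simp add: euclidean_inner[symmetric] power2_norm_eq_inner[symmetric])
    have Yxx: "Y' x x \<bullet> i = (\<Sum>j\<in>Basis. (x \<bullet> j) * (Y' x j \<bullet> i))" for i
    proof -
      have "Y' x x = Y' x (\<Sum>j\<in>Basis. (x \<bullet> j) *\<^sub>R j)" by (simp add: euclidean_representation)
      then show ?thesis
        by (simp add: linear_sum[OF lin[OF x]] linear_cmul[OF lin[OF x]] inner_sum_left)
    qed
    \<comment> \<open>The conditional term removes the diagonal \<open>i = j\<close>, where the
      velocity is zero; summed over \<open>j\<close> it turns the factor DIM into DIM - 1.\<close>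
    have Lij: "L i j x = (x \<bullet> i) * (Y x \<bullet> i) - (if j = i then (x \<bullet> i) * (Y x \<bullet> i) else 0)
       + ((x \<bullet> i) * ((x \<bullet> j) * (Y' x j \<bullet> i)) - ((x \<bullet> j) * (x \<bullet> j)) * (Y' x i \<bullet> i))"
      if "i \<in> Basis" "j \<in> Basis" for i j
      using that by (simp add: L_def inner_simps inner_Basis algebra_simps)
    have "(\<Sum>j\<in>Basis. L i j x) = (real DIM('a) - 1) * ((Y x \<bullet> i) * (x \<bullet> i))
       + ((Y' x x \<bullet> i) * (x \<bullet> i) - r\<^sup>2 * (Y' x i \<bullet> i))"
      if i: "i \<in> Basis" for i
    proof -
      have "(\<Sum>j\<in>Basis. L i j x) = (\<Sum>j\<in>Basis. (x \<bullet> i) * (Y x \<bullet> i) - (if j = i then (x \<bullet> i) * (Y x \<bullet> i) else 0)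
         + ((x \<bullet> i) * ((x \<bullet> j) * (Y' x j \<bullet> i)) - ((x \<bullet> j) * (x \<bullet> j)) * (Y' x i \<bullet> i)))"
        by (intro sum.cong refl Lij i)
      also have "\<dots> = real DIM('a) * ((x \<bullet> i) * (Y x \<bullet> i)) - (x \<bullet> i) * (Y x \<bullet> i)
         + ((x \<bullet> i) * (\<Sum>j\<in>Basis. (x \<bullet> j) * (Y' x j \<bullet> i)) - (\<Sum>j\<in>Basis. (x \<bullet> j) * (x \<bullet> j)) * (Y' x i \<bullet> i))"
        using i by (simp add: sum.distrib sum_subtractf sum_distrib_left sum_distrib_right)
      finally show ?thesis unfolding Yxx[symmetric] xx by (simp add: algebra_simps)
    qed
    then have "(\<Sum>i\<in>Basis. \<Sum>j\<in>Basis. L i j x) = (\<Sum>i\<in>Basis. (real DIM('a) - 1) * ((Y x \<bullet> i) * (x \<bullet> i))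
       + ((Y' x x \<bullet> i) * (x \<bullet> i) - r\<^sup>2 * (Y' x i \<bullet> i)))" by simp
    also have "\<dots> = (real DIM('a) - 1) * (Y x \<bullet> x) + (Y' x x \<bullet> x - r\<^sup>2 * (\<Sum>b\<in>Basis. Y' x b \<bullet> b))"
      unfolding sum.distrib sum_subtractf sum_distrib_left[symmetric] euclidean_inner[symmetric] ..
    finally show "(\<Sum>i\<in>Basis. \<Sum>j\<in>Basis. L i j x) = (real DIM('a) - 1) * (Y x \<bullet> x) + (-1) * (r\<^sup>2 * (\<Sum>b\<in>Basis. Y' x b \<bullet> b) - Y' x x \<bullet> x)"
      by simp
  qed
  moreover have "continuous_on (sphere 0 r) (\<lambda>x. r\<^sup>2 * (\<Sum>b\<in>Basis. Y' x b \<bullet> b) - Y' x x \<bullet> x)"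
  proof -
    have "continuous_on (sphere 0 r) (\<lambda>x. \<Sum>b\<in>Basis. (x \<bullet> b) *\<^sub>R Y' x b)"
      by (intro continuous_intros c)
    moreover have "(\<Sum>b\<in>Basis. (x \<bullet> b) *\<^sub>R Y' x b) = Y' x x" if "x \<in> sphere 0 r" for x
    proof -
      have "Y' x x = Y' x (\<Sum>j\<in>Basis. (x \<bullet> j) *\<^sub>R j)" by (simp add: euclidean_representation)
      then show ?thesis by (simp add: linear_sum[OF lin[OF that]] linear_cmul[OF lin[OF that]])
    qed
    ultimately have "continuous_on (sphere 0 r) (\<lambda>x. Y' x x)"
      by (rule continuous_on_eq)
    then show ?thesis by (intro continuous_intros c)
  qed
  moreover have "continuous_on (sphere 0 r) (\<lambda>x. Y x \<bullet> x)"
    by (intro continuous_intros cY)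
  ultimately show ?thesis
    using sphere_integral_add[OF r, of "\<lambda>x. (real DIM('a) - 1) * (Y x \<bullet> x)"
        "\<lambda>x. (-1) * (r\<^sup>2 * (\<Sum>b\<in>Basis. Y' x b \<bullet> b) - Y' x x \<bullet> x)"]
    by (simp only: sphere_integral_cmult continuous_on_mult_left)
qed

subsection \<open>Second derivatives of smooth fields\<close>

text \<open>Two uses of the mean value theorem: first in \<open>s\<close> for the difference of
  \<open>F\<close> between the sides \<open>t = h\<close> and \<open>t = 0\<close> of the
  parallelogram, then in \<open>t\<close> for the resulting difference of
  \<open>F' _ u\<close>.\<close>

lemma second_difference_mvt:
  fixes F :: "'a::real_normed_vector \<Rightarrow> real"
  assumes F: "\<And>y. y \<in> U \<Longrightarrow> (F has_derivative F' y) (at y)"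
    and Fu: "\<And>y. y \<in> U \<Longrightarrow> ((\<lambda>y. F' y u) has_derivative Hu y) (at y)"
    and h: "h > 0" and U: "\<And>s t. 0 \<le> s \<Longrightarrow> s \<le> h \<Longrightarrow> 0 \<le> t \<Longrightarrow> t \<le> h \<Longrightarrow> x + s *\<^sub>R u + t *\<^sub>R v \<in> U"
  obtains s t where "0 < s" "s < h" "0 < t" "t < h"
    "F (x + h *\<^sub>R u + h *\<^sub>R v) - F (x + h *\<^sub>R u) - F (x + h *\<^sub>R v) + F x
      = h\<^sup>2 * Hu (x + s *\<^sub>R u + t *\<^sub>R v) v"
proof -
  have d1: "((\<lambda>s. F (x + s *\<^sub>R u + t *\<^sub>R v)) has_real_derivative F' (x + s *\<^sub>R u + t *\<^sub>R v) u) (at s)"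
    if "0 \<le> s" "s \<le> h" "0 \<le> t" "t \<le> h" for s t
  proof -
    let ?y = "x + s *\<^sub>R u + t *\<^sub>R v"
    have "(F has_derivative F' ?y) (at ?y)" using F U that by blast
    moreover have "((\<lambda>s. x + s *\<^sub>R u + t *\<^sub>R v) has_derivative (\<lambda>a. a *\<^sub>R u)) (at s)"
      by (auto intro!: derivative_eq_intros)
    ultimately have "((\<lambda>s. F (x + s *\<^sub>R u + t *\<^sub>R v)) has_derivative (\<lambda>a. F' ?y (a *\<^sub>R u))) (at s)"
      by (rule has_derivative_compose[rotated])
    moreover have "F' ?y (a *\<^sub>R u) = F' ?y u * a" for a
      using linear_cmul[OF has_derivative_linear[OF \<open>(F has_derivative F' ?y) (at ?y)\<close>]] by simp
    ultimately show ?thesis by (simp add: has_field_derivative_def mult_commute_abs)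
  qed
  have d2: "((\<lambda>t. F' (x + s *\<^sub>R u + t *\<^sub>R v) u) has_real_derivative Hu (x + s *\<^sub>R u + t *\<^sub>R v) v) (at t)"
    if "0 \<le> s" "s \<le> h" "0 \<le> t" "t \<le> h" for s t
  proof -
    let ?y = "x + s *\<^sub>R u + t *\<^sub>R v"
    have H: "((\<lambda>y. F' y u) has_derivative Hu ?y) (at ?y)" using Fu U that by blast
    moreover have "((\<lambda>t. x + s *\<^sub>R u + t *\<^sub>R v) has_derivative (\<lambda>a. a *\<^sub>R v)) (at t)"
      by (auto intro!: derivative_eq_intros)
    ultimately have "((\<lambda>t. F' (x + s *\<^sub>R u + t *\<^sub>R v) u) has_derivative (\<lambda>a. Hu ?y (a *\<^sub>R v))) (at t)"
      by (rule has_derivative_compose[rotated])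
    moreover have "Hu ?y (a *\<^sub>R v) = Hu ?y v * a" for a
      using linear_cmul[OF has_derivative_linear[OF H]] by simp
    ultimately show ?thesis by (simp add: has_field_derivative_def mult_commute_abs)
  qed
  have "((\<lambda>s. F (x + s *\<^sub>R u + h *\<^sub>R v) - F (x + s *\<^sub>R u + 0 *\<^sub>R v)) has_real_derivative
      F' (x + s *\<^sub>R u + h *\<^sub>R v) u - F' (x + s *\<^sub>R u + 0 *\<^sub>R v) u) (at s)"
    if "0 \<le> s" "s \<le> h" for s
    using that h by (intro DERIV_diff d1) auto
  from MVT2[OF h this] obtain s where s: "0 < s" "s < h"
    "F (x + h *\<^sub>R u + h *\<^sub>R v) - F (x + h *\<^sub>R u) - (F (x + h *\<^sub>R v) - F x) =
     h * (F' (x + s *\<^sub>R u + h *\<^sub>R v) u - F' (x + s *\<^sub>R u) u)" by auto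
  have "\<exists>t>0. t < h \<and> F' (x + s *\<^sub>R u + h *\<^sub>R v) u - F' (x + s *\<^sub>R u + 0 *\<^sub>R v) u =
      (h - 0) * Hu (x + s *\<^sub>R u + t *\<^sub>R v) v"
    using s by (intro MVT2[OF h] d2) auto
  then obtain t where t: "0 < t" "t < h"
    "F' (x + s *\<^sub>R u + h *\<^sub>R v) u - F' (x + s *\<^sub>R u) u = h * Hu (x + s *\<^sub>R u + t *\<^sub>R v) v"
    by auto
  show ?thesis
    by (rule that[OF s(1,2) t(1,2)]) (use s(3) t(3) in \<open>simp add: power2_eq_square\<close>)
qed

text \<open>The second difference is symmetric in \<open>u\<close> and \<open>v\<close>. Evaluated
  in the two orders it gives equal values of \<open>Hu _ v\<close> and \<open>Hv _ u\<close> at two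
  points near \<open>x\<close>, and continuity excludes a gap at \<open>x\<close>.\<close>

lemma symmetric_second_derivative:
  fixes F :: "'a::real_normed_vector \<Rightarrow> real"
  assumes "open U" "x \<in> U"
    and F: "\<And>y. y \<in> U \<Longrightarrow> (F has_derivative F' y) (at y)"
    and Fu: "\<And>y. y \<in> U \<Longrightarrow> ((\<lambda>y. F' y u) has_derivative Hu y) (at y)"
    and Fv: "\<And>y. y \<in> U \<Longrightarrow> ((\<lambda>y. F' y v) has_derivative Hv y) (at y)"
    and cu: "isCont (\<lambda>y. Hu y v) x" and cv: "isCont (\<lambda>y. Hv y u) x"
  shows "Hu x v = Hv x u"
proof (rule ccontr)
  assume ne: "Hu x v \<noteq> Hv x u"
  define e where "e = \<bar>Hu x v - Hv x u\<bar> / 2"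
  have "e > 0" using ne by (simp add: e_def)
  obtain d0 where d0: "d0 > 0" "ball x d0 \<subseteq> U" using assms(1,2) open_contains_ball by blast
  obtain d1 where d1: "d1 > 0" "\<And>y. dist y x < d1 \<Longrightarrow> dist (Hu y v) (Hu x v) < e"
    using cu \<open>e > 0\<close> unfolding continuous_at_eps_delta by blast
  obtain d2 where d2: "d2 > 0" "\<And>y. dist y x < d2 \<Longrightarrow> dist (Hv y u) (Hv x u) < e"
    using cv \<open>e > 0\<close> unfolding continuous_at_eps_delta by blast
  define d where "d = min d0 (min d1 d2)"
  have "d > 0" using d0 d1 d2 by (simp add: d_def)
  \<comment> \<open>Small enough for the whole parallelogram to lie within distance \<open>d\<close>
    of \<open>x\<close>; the summand 1 keeps the quotient meaningful when \<open>u\<close> and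
    \<open>v\<close> are both zero.\<close>
  define h where "h = d / (norm u + norm v + 1)"
  have n: "norm u + norm v + 1 > 0" using norm_ge_zero[of u] norm_ge_zero[of v] by linarith
  have "h > 0" using \<open>d > 0\<close> n by (simp add: h_def)
  have hd: "h * norm u + h * norm v < d"
  proof -
    have "h * (norm u + norm v + 1) = d" using n by (simp add: h_def)
    then show ?thesis using \<open>h > 0\<close> by (simp add: distrib_left)
  qed
  have near: "dist (x + s *\<^sub>R u + t *\<^sub>R v) x < d" if "0 \<le> s" "s \<le> h" "0 \<le> t" "t \<le> h" for s t
  proof -
    have "dist (x + s *\<^sub>R u + t *\<^sub>R v) x = norm (s *\<^sub>R u + t *\<^sub>R v)"
      by (simp add: dist_norm add.assoc)
    also have "\<dots> \<le> s * norm u + t * norm v"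
      using norm_triangle_ineq[of "s *\<^sub>R u" "t *\<^sub>R v"] that by simp
    also have "\<dots> \<le> h * norm u + h * norm v"
      using that by (intro add_mono mult_right_mono) auto
    finally show ?thesis using hd by simp
  qed
  then have inU: "x + s *\<^sub>R u + t *\<^sub>R v \<in> U" if "0 \<le> s" "s \<le> h" "0 \<le> t" "t \<le> h" for s t
    using d0(2) near[OF that] by (auto simp: d_def dist_commute mem_ball)
  obtain s t where st: "0 < s" "s < h" "0 < t" "t < h"
    "F (x + h *\<^sub>R u + h *\<^sub>R v) - F (x + h *\<^sub>R u) - F (x + h *\<^sub>R v) + F x
      = h\<^sup>2 * Hu (x + s *\<^sub>R u + t *\<^sub>R v) v"
    using second_difference_mvt[OF F Fu \<open>h > 0\<close> inU] by blast
  have inU': "x + s *\<^sub>R v + t *\<^sub>R u \<in> U" if "0 \<le> s" "s \<le> h" "0 \<le> t" "t \<le> h" for s t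
    using inU[OF that(3,4,1,2)] by (simp add: ac_simps)
  obtain s' t' where st': "0 < s'" "s' < h" "0 < t'" "t' < h"
    "F (x + h *\<^sub>R v + h *\<^sub>R u) - F (x + h *\<^sub>R v) - F (x + h *\<^sub>R u) + F x
      = h\<^sup>2 * Hv (x + s' *\<^sub>R v + t' *\<^sub>R u) u"
    using second_difference_mvt[OF F Fv \<open>h > 0\<close> inU'] by blast
  have "h\<^sup>2 * Hu (x + s *\<^sub>R u + t *\<^sub>R v) v = h\<^sup>2 * Hv (x + s' *\<^sub>R v + t' *\<^sub>R u) u"
  proof -
    have "F (x + h *\<^sub>R v + h *\<^sub>R u) = F (x + h *\<^sub>R u + h *\<^sub>R v)" by (simp add: ac_simps)
    then show ?thesis using st(5) st'(5) by linarith
  qed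
  then have "Hu (x + s *\<^sub>R u + t *\<^sub>R v) v = Hv (x + t' *\<^sub>R u + s' *\<^sub>R v) u"
    using \<open>h > 0\<close> by (simp add: ac_simps)
  moreover have "dist (Hu (x + s *\<^sub>R u + t *\<^sub>R v) v) (Hu x v) < e"
    using near[of s t] st by (intro d1(2)) (auto simp: d_def)
  moreover have "dist (Hv (x + t' *\<^sub>R u + s' *\<^sub>R v) u) (Hv x u) < e"
    using near[of t' s'] st' by (intro d2(2)) (auto simp: d_def)
  ultimately show False unfolding dist_real_def e_def by (smt (verit) field_sum_of_halves)
qed

section \<open>First and second derivatives of a smooth vector field\<close>

locale smooth_field =
  fixes U :: "'a::euclidean_space set" and X :: "'a \<Rightarrow> 'a"
  assumes open_U: "open U" and smooth: "smooth_on U X"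
begin

definition D :: "'a \<Rightarrow> 'a \<Rightarrow> 'a" where
  "D x v = frechet_derivative X (at x) v"

text \<open>The direction \<open>w\<close> belongs to the outer differentiation and \<open>v\<close>
  to the inner one; linearity in \<open>v\<close> therefore has to be derived.\<close>

definition H :: "'a \<Rightarrow> 'a \<Rightarrow> 'a \<Rightarrow> 'a" where
  "H x w v = frechet_derivative (\<lambda>y. D y v) (at x) w"

lemma has_derivative_D: "x \<in> U \<Longrightarrow> (X has_derivative D x) (at x)"
proof -
  assume x: "x \<in> U"
  have "Cdiff (Suc 0) U X" using smooth unfolding smooth_on_def by blast
  then have "X differentiable at x within U" using x by (simp add: differentiable_on_def)
  then have "X differentiable at x" by (simp add: at_within_open[OF x open_U])
  then show ?thesis by (simp add: frechet_derivative_works D_def[abs_def])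
qed

lemma linear_D: "x \<in> U \<Longrightarrow> linear (D x)"
  using has_derivative_D has_derivative_linear by blast

lemma D_expand: "x \<in> U \<Longrightarrow> D x v = (\<Sum>b\<in>Basis. (v \<bullet> b) *\<^sub>R D x b)"
  by (subst (1) euclidean_representation[of v, symmetric])
    (simp add: linear_sum[OF linear_D] linear_cmul[OF linear_D])

text \<open>Smoothness speaks only of basis directions; other directions follow by expanding
  \<open>D y v\<close> in the basis near \<open>x\<close>.\<close>

lemma has_derivative_H:
  assumes x: "x \<in> U"
  shows "((\<lambda>y. D y v) has_derivative (\<lambda>w. H x w v)) (at x)"
proof -
  have b: "((\<lambda>y. D y b) has_derivative (\<lambda>w. H x w b)) (at x)" if "b \<in> Basis" for b
  proof -
    have "Cdiff (Suc (Suc 0)) U X" using smooth unfolding smooth_on_def by blast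
    then have "(\<lambda>y. D y b) differentiable_on U" using that by (simp add: D_def)
    then have "(\<lambda>y. D y b) differentiable at x within U" using x by (simp add: differentiable_on_def)
    then have "(\<lambda>y. D y b) differentiable at x" by (simp add: at_within_open[OF x open_U])
    then show ?thesis by (simp add: frechet_derivative_works H_def[abs_def])
  qed
  have "((\<lambda>y. \<Sum>b\<in>Basis. (v \<bullet> b) *\<^sub>R D y b) has_derivative (\<lambda>w. \<Sum>b\<in>Basis. (v \<bullet> b) *\<^sub>R H x w b)) (at x)"
    by (intro has_derivative_sum has_derivative_scaleR_right b)
  then have "((\<lambda>y. D y v) has_derivative (\<lambda>w. \<Sum>b\<in>Basis. (v \<bullet> b) *\<^sub>R H x w b)) (at x)"
    by (rule has_derivative_transform_within_open[OF _ open_U x]) (rule D_expand[symmetric])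
  then have "(\<lambda>y. D y v) differentiable at x" by (rule differentiableI)
  then show ?thesis by (simp add: frechet_derivative_works H_def[abs_def])
qed

lemma linear_H: "x \<in> U \<Longrightarrow> linear (\<lambda>w. H x w v)"
  using has_derivative_H has_derivative_linear by blast

lemma continuous_on_D: "continuous_on U (\<lambda>x. D x v)"
  using has_derivative_H by (intro continuous_at_imp_continuous_on) (blast intro: has_derivative_continuous)

lemma continuous_on_X: "continuous_on U X"
  using has_derivative_D by (intro continuous_at_imp_continuous_on) (blast intro: has_derivative_continuous)

lemma H_expand:
  assumes x: "x \<in> U"
  shows "H x w v = (\<Sum>b\<in>Basis. (v \<bullet> b) *\<^sub>R H x w b)"
proof -
  have "((\<lambda>y. \<Sum>b\<in>Basis. (v \<bullet> b) *\<^sub>R D y b) has_derivative (\<lambda>w. \<Sum>b\<in>Basis. (v \<bullet> b) *\<^sub>R H x w b)) (at x)"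
    by (intro has_derivative_sum has_derivative_scaleR_right has_derivative_H x)
  then have "((\<lambda>y. D y v) has_derivative (\<lambda>w. \<Sum>b\<in>Basis. (v \<bullet> b) *\<^sub>R H x w b)) (at x)"
    by (rule has_derivative_transform_within_open[OF _ open_U x]) (rule D_expand[symmetric])
  from fun_cong[OF has_derivative_unique[OF has_derivative_H[OF x] this]] show ?thesis .
qed

lemma continuous_on_H: "continuous_on U (\<lambda>x. H x w v)"
proof -
  have b: "continuous_on U (\<lambda>x. H x c b)" if "b \<in> Basis" "c \<in> Basis" for b c
  proof -
    have "Cdiff (Suc (Suc 0)) U X" using smooth unfolding smooth_on_def by blast
    then show ?thesis using that by (simp add: D_def H_def)
  qed
  have "continuous_on U (\<lambda>x. \<Sum>b\<in>Basis. (v \<bullet> b) *\<^sub>R (\<Sum>c\<in>Basis. (w \<bullet> c) *\<^sub>R H x c b))"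
    by (intro continuous_on_sum continuous_on_scaleR continuous_on_const b)
  moreover have "(\<Sum>b\<in>Basis. (v \<bullet> b) *\<^sub>R (\<Sum>c\<in>Basis. (w \<bullet> c) *\<^sub>R H x c b)) = H x w v" if "x \<in> U" for x
  proof -
    have eq: "H x w b = (\<Sum>c\<in>Basis. (w \<bullet> c) *\<^sub>R H x c b)" for b
      by (subst (1) euclidean_representation[of w, symmetric])
        (simp add: linear_sum[OF linear_H[OF that]] linear_cmul[OF linear_H[OF that]])
    show ?thesis unfolding H_expand[OF that, of w v] by (simp only: eq[symmetric])
  qed
  ultimately show ?thesis by (rule continuous_on_eq)
qed

text \<open>The symmetry lemma for real functions is applied to each component of
  \<open>X\<close>.\<close>

lemma H_sym:
  assumes x: "x \<in> U"
  shows "H x u v = H x v u"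
proof (rule euclidean_eqI)
  fix b :: 'a assume "b \<in> Basis"
  have X: "((\<lambda>x. X x \<bullet> b) has_derivative (\<lambda>v. D y v \<bullet> b)) (at y)" if "y \<in> U" for y
    by (intro has_derivative_inner_left has_derivative_D that)
  have D: "((\<lambda>y. D y v \<bullet> b) has_derivative (\<lambda>w. H y w v \<bullet> b)) (at y)" if "y \<in> U" for y v
    by (intro has_derivative_inner_left has_derivative_H that)
  have "continuous_on U (\<lambda>y. H y w v \<bullet> b)" for w v
    by (intro continuous_intros continuous_on_H)
  then have "isCont (\<lambda>y. H y w v \<bullet> b) x" for w v
    using x open_U continuous_on_eq_continuous_at by blast
  from symmetric_second_derivative[OF open_U x X D D this this]
  show "H x u v \<bullet> b = H x v u \<bullet> b" .
qed

text \<open>The direction \<open>X y\<close> moves with the point, so \<open>D y (X y)\<close> is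
  expanded in the fixed basis and the product rule applied; the two terms come from the moving base
  point and the moving direction.\<close>

lemma has_derivative_DX:
  assumes x: "x \<in> U"
  shows "((\<lambda>y. D y (X y)) has_derivative (\<lambda>w. H x w (X x) + D x (D x w))) (at x)"
proof -
  have "((\<lambda>y. \<Sum>b\<in>Basis. (X y \<bullet> b) *\<^sub>R D y b) has_derivative
      (\<lambda>w. \<Sum>b\<in>Basis. (X x \<bullet> b) *\<^sub>R H x w b + (D x w \<bullet> b) *\<^sub>R D x b)) (at x)"
    by (intro has_derivative_sum has_derivative_scaleR has_derivative_H has_derivative_inner_left has_derivative_D x)
  also have "(\<lambda>w. \<Sum>b\<in>Basis. (X x \<bullet> b) *\<^sub>R H x w b + (D x w \<bullet> b) *\<^sub>R D x b) = (\<lambda>w. H x w (X x) + D x (D x w))"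
    unfolding sum.distrib D_expand[OF x, symmetric] H_expand[OF x, symmetric] ..
  finally show ?thesis
    by (rule has_derivative_transform_within_open[OF _ open_U x]) (rule D_expand[symmetric])
qed

end

subsection \<open>The covariant derivative of a tangent field\<close>

lemma tproj_in_tangent_space:
  assumes "p \<noteq> 0"
  shows "tproj p v \<in> tangent_space p"
  using assms by (simp add: tproj_def tangent_space_def inner_simps)

lemma subspace_tangent_space: "subspace (tangent_space p)"
  by (simp add: subspace_def tangent_space_def inner_simps)

text \<open>Makes the basis picked by choice in \<open>nabla_norm2\<close> usable.\<close>

lemma orthonormal_basis_of_tangent_space:
  "orthonormal_basis_of (SOME B. orthonormal_basis_of B (tangent_space p)) (tangent_space p)"
proof (rule someI_ex)
  obtain B where "B \<subseteq> tangent_space p" "pairwise orthogonal B" "\<And>x. x \<in> B \<Longrightarrow> norm x = 1"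
    "independent B" "span B = tangent_space p"
    using orthonormal_basis_subspace[OF subspace_tangent_space[of p]] by metis
  then have "orthonormal_basis_of B (tangent_space p)"
    unfolding orthonormal_basis_of_def by (auto intro: independent_imp_finite)
  then show "\<exists>B. orthonormal_basis_of B (tangent_space p)" ..
qed

context
  fixes E :: "'a::euclidean_space set" and p :: 'a
  assumes E: "orthonormal_basis_of E (tangent_space p)"
begin

lemma onb_finite: "finite E"
  using E by (simp add: orthonormal_basis_of_def)

lemma onb_tangent: "e \<in> E \<Longrightarrow> e \<bullet> p = 0"
  using E by (auto simp: orthonormal_basis_of_def tangent_space_def)

lemma onb_inner: "e \<in> E \<Longrightarrow> f \<in> E \<Longrightarrow> e \<bullet> f = (if e = f then 1 else 0)"
  using E by (auto simp: orthonormal_basis_of_def pairwise_def orthogonal_def norm_eq_1)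

lemma onb_expand: "v \<in> tangent_space p \<Longrightarrow> (\<Sum>e\<in>E. (v \<bullet> e) *\<^sub>R e) = v"
  using E by (intro orthonormal_basis_expand) (auto simp: orthonormal_basis_of_def)

lemma onb_parseval:
  assumes "v \<in> tangent_space p"
  shows "v \<bullet> w = (\<Sum>e\<in>E. (v \<bullet> e) * (w \<bullet> e))"
  by (subst (1) onb_expand[OF assms, symmetric]) (simp add: inner_sum_left inner_commute[of w])

lemma tproj_expand:
  assumes "p \<noteq> 0"
  shows "tproj p v = (\<Sum>e\<in>E. (v \<bullet> e) *\<^sub>R e)"
proof -
  have "tproj p v \<bullet> e = v \<bullet> e" if "e \<in> E" for e
    using onb_tangent[OF that] by (simp add: tproj_def inner_simps inner_commute)
  then show ?thesis
    using onb_expand[OF tproj_in_tangent_space[OF assms, of v]] by simp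
qed

text \<open>Together with the normalised \<open>p\<close>, the set \<open>E\<close> is an
  orthonormal basis of the whole space, so the tangential trace is the full trace minus the normal
  entry. The proof evaluates the sum of \<open>B (tproj p b) (tproj p b)\<close> over
  \<open>Basis\<close> in two ways: by expanding in \<open>E\<close>, and by the definition of
  \<open>tproj\<close>.\<close>

lemma onb_trace:
  fixes B :: "'a \<Rightarrow> 'a \<Rightarrow> real"
  assumes p: "p \<noteq> 0" and l: "\<And>y. linear (\<lambda>x. B x y)" and r: "\<And>x. linear (B x)"
  shows "(\<Sum>e\<in>E. B e e) = (\<Sum>b\<in>Basis. B b b) - B p p / (p \<bullet> p)"
proof -
  have pp: "p \<bullet> p \<noteq> 0" using p by simp
  have ex: "(\<Sum>b\<in>Basis. (x \<bullet> b) * B b y) = B x y" "(\<Sum>b\<in>Basis. (y \<bullet> b) * B x b) = B x y" for x y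
    using linear_sum[OF l, of "\<lambda>b. (x \<bullet> b) *\<^sub>R b" Basis y] linear_sum[OF r, of x "\<lambda>b. (y \<bullet> b) *\<^sub>R b" Basis]
    by (simp_all add: linear_cmul[OF l] linear_cmul[OF r] euclidean_representation)
  have "(\<Sum>b\<in>Basis. B (tproj p b) (tproj p b)) = (\<Sum>b\<in>Basis. \<Sum>e\<in>E. \<Sum>f\<in>E. (b \<bullet> e) * (b \<bullet> f) * B e f)"
    unfolding tproj_expand[OF p]
    by (simp only: linear_sum[OF l] linear_cmul[OF l])
      (simp add: linear_sum[OF r] linear_cmul[OF r] sum_distrib_left mult.assoc)
  also have "\<dots> = (\<Sum>e\<in>E. \<Sum>b\<in>Basis. \<Sum>f\<in>E. (b \<bullet> e) * (b \<bullet> f) * B e f)"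
    by (rule sum.swap)
  also have "\<dots> = (\<Sum>e\<in>E. \<Sum>f\<in>E. \<Sum>b\<in>Basis. (b \<bullet> e) * (b \<bullet> f) * B e f)"
    by (intro sum.cong refl sum.swap)
  also have "\<dots> = (\<Sum>e\<in>E. \<Sum>f\<in>E. (e \<bullet> f) * B e f)"
    by (intro sum.cong refl, subst euclidean_inner) (simp add: sum_distrib_right inner_commute)
  also have "\<dots> = (\<Sum>e\<in>E. B e e)"
  proof (rule sum.cong[OF refl])
    fix e assume e: "e \<in> E"
    have "(\<Sum>f\<in>E. (e \<bullet> f) * B e f) = (\<Sum>f\<in>E. if e = f then B e f else 0)"
      by (rule sum.cong) (auto simp: onb_inner[OF e])
    then show "(\<Sum>f\<in>E. (e \<bullet> f) * B e f) = B e e" using e onb_finite by simp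
  qed
  finally have 1: "(\<Sum>b\<in>Basis. B (tproj p b) (tproj p b)) = (\<Sum>e\<in>E. B e e)" .
  have "B (tproj p b) (tproj p b) = B b b - ((p \<bullet> b) * B b p) / (p \<bullet> p) - ((p \<bullet> b) * B p b) / (p \<bullet> p)
      + (p \<bullet> b) * (p \<bullet> b) * (B p p / (p \<bullet> p)\<^sup>2)" for b
    unfolding tproj_def
    by (simp add: linear_diff[OF l] linear_diff[OF r] linear_cmul[OF l] linear_cmul[OF r]
      inner_commute power2_eq_square algebra_simps)
  then have "(\<Sum>b\<in>Basis. B (tproj p b) (tproj p b)) = (\<Sum>b\<in>Basis. B b b) - (\<Sum>b\<in>Basis. (p \<bullet> b) * B b p) / (p \<bullet> p)
      - (\<Sum>b\<in>Basis. (p \<bullet> b) * B p b) / (p \<bullet> p) + (\<Sum>b\<in>Basis. (p \<bullet> b) * (p \<bullet> b)) * (B p p / (p \<bullet> p)\<^sup>2)"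
    by (simp only: sum.distrib sum_subtractf sum_divide_distrib sum_distrib_right)
  also have "\<dots> = (\<Sum>b\<in>Basis. B b b) - B p p / (p \<bullet> p)"
    unfolding ex euclidean_inner[symmetric] using pp by (simp add: power2_eq_square)
  finally show ?thesis using 1 by simp
qed

text \<open>The trace formula for the inner product itself counts the basis vectors.\<close>

lemma card_onb:
  assumes "p \<noteq> 0"
  shows "real (card E) = real DIM('a) - 1"
proof -
  have "(\<Sum>e\<in>E. e \<bullet> e) = (\<Sum>b\<in>(Basis::'a set). b \<bullet> b) - (p \<bullet> p) / (p \<bullet> p)"
    using assms by (intro onb_trace linearI) (auto simp: inner_simps)
  moreover have "(\<Sum>e\<in>E. e \<bullet> e) = (\<Sum>e\<in>E. 1)" by (rule sum.cong) (auto simp: onb_inner)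
  ultimately show ?thesis using assms by simp
qed

end

section \<open>Tangent fields on the sphere and the invariants of their covariant derivative\<close>

locale tangent_field = smooth_field U X
  for U :: "'a::euclidean_space set" and X :: "'a \<Rightarrow> 'a" +
  fixes r :: real
  assumes r_pos: "r > 0" and sphere_U: "sphere 0 r \<subseteq> U"
    and tangent: "\<And>p. p \<in> sphere 0 r \<Longrightarrow> X p \<bullet> p = 0"
begin

lemma in_U: "p \<in> sphere 0 r \<Longrightarrow> p \<in> U"
  using sphere_U by blast

lemma sphere_nonzero: "p \<in> sphere 0 r \<Longrightarrow> p \<noteq> 0"
  using r_pos by auto

lemma sphere_inner: "p \<in> sphere 0 r \<Longrightarrow> p \<bullet> p = r\<^sup>2"
  by (simp add: power2_norm_eq_inner[symmetric])

text \<open>Tangency is known only on the sphere, so the relation \<open>X \<bullet> c = 0\<close>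
  is differentiated along a great circle \<open>c\<close> leaving \<open>p\<close> in the direction
  of \<open>v\<close>.\<close>

lemma D_normal:
  assumes p: "p \<in> sphere 0 r" and v: "v \<bullet> p = 0"
  shows "D p v \<bullet> p = - (X p \<bullet> v)"
proof (cases "v = 0")
  case True
  then show ?thesis using linear_0[OF linear_D[OF in_U[OF p]]] by simp
next
  case False
  \<comment> \<open>Rescaled to length \<open>r\<close>, so that the curve \<open>c\<close> below
    stays on the sphere; the factor is undone at the end by evaluating at
    \<open>norm v / r\<close>.\<close>
  define w where "w = (r / norm v) *\<^sub>R v"
  have vw: "v = (norm v / r) *\<^sub>R w" using False r_pos by (simp add: w_def)
  have w: "w \<bullet> w = r\<^sup>2" "w \<bullet> p = 0" "p \<bullet> w = 0"
    using False v by (simp_all add: w_def inner_commute power2_norm_eq_inner[symmetric] power2_eq_square)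
  define c where "c t = cos t *\<^sub>R p + sin t *\<^sub>R w" for t
  have cs: "c t \<in> sphere 0 r" for t
  proof -
    have "c t \<bullet> c t = (cos t)\<^sup>2 * r\<^sup>2 + (sin t)\<^sup>2 * r\<^sup>2"
      by (simp add: c_def inner_simps w sphere_inner[OF p] power2_eq_square)
    then have "c t \<bullet> c t = r\<^sup>2" by (simp add: distrib_right[symmetric])
    then have "(norm (c t))\<^sup>2 = r\<^sup>2" by (simp add: power2_norm_eq_inner)
    then show ?thesis using r_pos by simp
  qed
  have c0: "c 0 = p" by (simp add: c_def)
  have dc: "(c has_derivative (\<lambda>s. s *\<^sub>R w)) (at 0)"
    unfolding c_def by (auto intro!: derivative_eq_intros)
  have "(X has_derivative D p) (at (c 0))" unfolding c0 by (rule has_derivative_D[OF in_U[OF p]])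
  from has_derivative_compose[OF dc this]
  have dX: "((\<lambda>t. X (c t)) has_derivative (\<lambda>s. D p (s *\<^sub>R w))) (at 0)" .
  have "((\<lambda>t. X (c t) \<bullet> c t) has_derivative (\<lambda>s. X (c 0) \<bullet> (s *\<^sub>R w) + D p (s *\<^sub>R w) \<bullet> c 0)) (at 0)"
    by (rule has_derivative_inner[OF dX dc])
  moreover have "(\<lambda>t. X (c t) \<bullet> c t) = (\<lambda>_. 0)" using tangent[OF cs] by auto
  ultimately have "(\<lambda>s. X p \<bullet> (s *\<^sub>R w) + D p (s *\<^sub>R w) \<bullet> p) = (\<lambda>_. 0)"
    unfolding c0 using has_derivative_unique[OF _ has_derivative_const] by metis
  from fun_cong[OF this, of "norm v / r"] show ?thesis
    unfolding vw[symmetric] by simp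
qed

lemma nabla_inner: "w \<bullet> p = 0 \<Longrightarrow> nabla X p v \<bullet> w = D p v \<bullet> w"
  by (simp add: nabla_def tproj_def D_def inner_diff_left inner_commute[of p w])

lemma continuous_on_D_compose:
  assumes "S \<subseteq> U" "continuous_on S g"
  shows "continuous_on S (\<lambda>x. D x (g x))"
proof -
  have "continuous_on S (\<lambda>x. \<Sum>b\<in>Basis. (g x \<bullet> b) *\<^sub>R D x b)"
    by (intro continuous_intros assms continuous_on_subset[OF continuous_on_D])
  then show ?thesis
    by (rule continuous_on_eq) (use assms in \<open>auto simp: D_expand[symmetric]\<close>)
qed

lemma continuous_on_H_compose:
  assumes "S \<subseteq> U" "continuous_on S g"
  shows "continuous_on S (\<lambda>x. H x w (g x))"
proof -
  have "continuous_on S (\<lambda>x. \<Sum>b\<in>Basis. (g x \<bullet> b) *\<^sub>R H x w b)"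
    by (intro continuous_intros assms continuous_on_subset[OF continuous_on_H])
  then show ?thesis
    by (rule continuous_on_eq) (use assms in \<open>auto simp: H_expand[symmetric]\<close>)
qed

lemmas continuous_on_sphere_D = continuous_on_D_compose[OF sphere_U]
  and continuous_on_sphere_H = continuous_on_H_compose[OF sphere_U]
  and continuous_on_sphere_X = continuous_on_subset[OF continuous_on_X sphere_U]

text \<open>Let \<open>A\<close> be the endomorphism \<open>v \<mapsto> \<nabla>\<^sub>v X\<close> of the tangent space at \<open>p\<close>. The next three functions
  are \<open>tr A\<close>, \<open>tr A\<^sup>2\<close> and \<open>|A|\<^sup>2\<close>, written in ambient coordinates so that their continuity in
  \<open>p\<close> is visible; the first one also has to be differentiated.\<close>

definition trA :: "'a \<Rightarrow> real" where
  "trA p = (\<Sum>b\<in>Basis. D p b \<bullet> b) - (D p p \<bullet> p) / r\<^sup>2"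

definition trA2 :: "'a \<Rightarrow> real" where
  "trA2 p = (\<Sum>b\<in>Basis. D p (D p b) \<bullet> b) - (D p (D p p) \<bullet> p) / r\<^sup>2 + (D p p \<bullet> X p) / r\<^sup>2"

definition normA2 :: "'a \<Rightarrow> real" where
  "normA2 p = (\<Sum>b\<in>Basis. tproj p (D p b) \<bullet> tproj p (D p b)) - (tproj p (D p p) \<bullet> tproj p (D p p)) / r\<^sup>2"

lemma continuous_on_trA: "continuous_on (sphere 0 r) trA"
  unfolding trA_def[abs_def] using r_pos by (intro continuous_intros continuous_on_sphere_D) auto

lemma continuous_on_trA2: "continuous_on (sphere 0 r) trA2"
  unfolding trA2_def[abs_def] using r_pos
  by (intro continuous_intros continuous_on_sphere_D continuous_on_sphere_X) auto

lemma continuous_on_normA2: "continuous_on (sphere 0 r) normA2"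
  unfolding normA2_def[abs_def] tproj_def using r_pos
  by (intro continuous_intros continuous_on_sphere_D) auto

context
  fixes p :: 'a and E :: "'a set"
  assumes p: "p \<in> sphere 0 r" and E: "orthonormal_basis_of E (tangent_space p)"
begin

lemma linear_Dp: "linear (D p)"
  by (rule linear_D[OF in_U[OF p]])

lemma linear_Dp_inner: "linear (\<lambda>x. D p x \<bullet> y)" "linear (\<lambda>x. D p (D p x) \<bullet> y)" "linear (\<lambda>x. y \<bullet> x)"
  using linear_Dp by (auto simp: linear_iff inner_simps)

lemma trA_onb: "trA p = (\<Sum>e\<in>E. D p e \<bullet> e)"
  unfolding trA_def
  by (subst onb_trace[OF E sphere_nonzero[OF p] linear_Dp_inner(1,3)]) (simp add: sphere_inner[OF p])

text \<open>As a trace of a bilinear form the sum is the same for every orthonormal basis, which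
  makes the choice inside \<open>nabla_norm2\<close> harmless.\<close>

lemma normA2_nabla: "normA2 p = (\<Sum>e\<in>E. (norm (nabla X p e))\<^sup>2)"
proof -
  have l: "linear (\<lambda>x. tproj p (D p x) \<bullet> y)" "linear (\<lambda>x. y \<bullet> tproj p (D p x))" for y
    using linear_Dp by (auto simp: linear_iff tproj_def inner_simps add_divide_distrib algebra_simps)
  show ?thesis unfolding normA2_def nabla_def D_def[symmetric] power2_norm_eq_inner
    by (subst onb_trace[OF E sphere_nonzero[OF p] l]) (simp add: sphere_inner[OF p])
qed

lemma normA2_onb: "normA2 p = (\<Sum>e\<in>E. \<Sum>f\<in>E. (D p e \<bullet> f)\<^sup>2)"
proof -
  have "(norm (nabla X p e))\<^sup>2 = (\<Sum>f\<in>E. (D p e \<bullet> f)\<^sup>2)" for e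
  proof -
    have T: "nabla X p e \<in> tangent_space p"
      unfolding nabla_def by (rule tproj_in_tangent_space[OF sphere_nonzero[OF p]])
    have "nabla X p e \<bullet> f = D p e \<bullet> f" if "f \<in> E" for f
      by (rule nabla_inner[OF onb_tangent[OF E that]])
    then show ?thesis unfolding power2_norm_eq_inner
      by (subst onb_parseval[OF E T]) (simp add: power2_eq_square)
  qed
  then show ?thesis using normA2_nabla by simp
qed

text \<open>Squaring the ambient \<open>D p\<close> also passes through the normal component of
  \<open>D p f\<close>. By \<open>D_normal\<close> this component is determined by
  \<open>X p\<close>, and removing it produces the last term of \<open>trA2\<close>.\<close>

lemma trA2_onb: "trA2 p = (\<Sum>e\<in>E. \<Sum>f\<in>E. (D p e \<bullet> f) * (D p f \<bullet> e))"
proof -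
  have nz: "p \<noteq> 0" by (rule sphere_nonzero[OF p])
  have inner: "(\<Sum>e\<in>E. (D p e \<bullet> f) * (D p f \<bullet> e)) = D p (D p f) \<bullet> f + (D p p \<bullet> f) * (X p \<bullet> f) / r\<^sup>2"
    if f: "f \<in> E" for f
  proof -
    have "(\<Sum>e\<in>E. (D p e \<bullet> f) * (D p f \<bullet> e)) =
       (\<Sum>b\<in>Basis. (D p b \<bullet> f) * (D p f \<bullet> b)) - (D p p \<bullet> f) * (D p f \<bullet> p) / (p \<bullet> p)"
      using linear_Dp by (intro onb_trace[OF E nz]) (auto simp: linear_iff inner_simps algebra_simps)
    also have "(\<Sum>b\<in>Basis. (D p b \<bullet> f) * (D p f \<bullet> b)) = D p (D p f) \<bullet> f"
      by (subst (3) D_expand[OF in_U[OF p]]) (simp add: inner_sum_left mult.commute)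
    also have "D p f \<bullet> p = - (X p \<bullet> f)"
      by (rule D_normal[OF p onb_tangent[OF E f]])
    finally show ?thesis by (simp add: sphere_inner[OF p])
  qed
  have "(\<Sum>e\<in>E. \<Sum>f\<in>E. (D p e \<bullet> f) * (D p f \<bullet> e)) = (\<Sum>f\<in>E. \<Sum>e\<in>E. (D p e \<bullet> f) * (D p f \<bullet> e))"
    by (rule sum.swap)
  also have "\<dots> = (\<Sum>f\<in>E. D p (D p f) \<bullet> f + (D p p \<bullet> f) * (X p \<bullet> f) / r\<^sup>2)"
    by (intro sum.cong refl inner)
  also have "\<dots> = (\<Sum>f\<in>E. D p (D p f) \<bullet> f) + (\<Sum>f\<in>E. (X p \<bullet> f) * (D p p \<bullet> f)) / r\<^sup>2"
    by (simp add: sum.distrib sum_divide_distrib mult.commute)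
  also have "(\<Sum>f\<in>E. (X p \<bullet> f) * (D p p \<bullet> f)) = D p p \<bullet> X p"
    using onb_parseval[OF E, of "X p" "D p p"] tangent[OF p]
    by (simp add: tangent_space_def inner_commute[of "D p p" "X p"])
  also have "(\<Sum>f\<in>E. D p (D p f) \<bullet> f) = (\<Sum>b\<in>Basis. D p (D p b) \<bullet> b) - (D p (D p p) \<bullet> p) / r\<^sup>2"
    by (subst onb_trace[OF E nz linear_Dp_inner(2,3)]) (simp add: sphere_inner[OF p])
  finally show ?thesis by (simp add: trA2_def)
qed

text \<open>With \<open>n\<close> the dimension of the sphere and \<open>S\<close> the symmetric
  part of A, Cauchy-Schwarz on the diagonal gives (tr A)^2 \<le> n |S|^2, while 2 |S|^2 = |A|^2 + tr
  A^2. The remaining surplus of tr A^2 is absorbed by tr A^2 \<le> |A|^2.\<close>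

lemma trA_le:
  assumes "DIM('a) \<ge> 3"
  shows "(trA p)\<^sup>2 - trA2 p \<le> (real DIM('a) - 2) * normA2 p"
proof -
  define n where "n = real DIM('a) - 1"
  define a where "a e f = D p e \<bullet> f" for e f
  define S where "S e f = (a e f + a f e) / 2" for e f
  have n: "real (card E) = n" "n \<ge> 2"
    using card_onb[OF E sphere_nonzero[OF p]] assms by (auto simp: n_def)
  have N: "normA2 p = (\<Sum>e\<in>E. \<Sum>f\<in>E. (a e f)\<^sup>2)" by (simp add: normA2_onb a_def)
  have N': "normA2 p = (\<Sum>e\<in>E. \<Sum>f\<in>E. (a f e)\<^sup>2)" unfolding N by (rule sum.swap)
  have T: "trA2 p = (\<Sum>e\<in>E. \<Sum>f\<in>E. a e f * a f e)" by (simp add: trA2_onb a_def)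
  have "(\<Sum>e\<in>E. \<Sum>f\<in>E. (S e f)\<^sup>2) = (normA2 p + normA2 p + 2 * trA2 p) / 4"
    unfolding N' T by (subst (1) N'[symmetric], unfold N)
      (simp add: S_def power_divide power2_sum sum.distrib sum_divide_distrib[symmetric] sum_distrib_left mult.assoc add_divide_distrib)
  then have S: "2 * (\<Sum>e\<in>E. \<Sum>f\<in>E. (S e f)\<^sup>2) = normA2 p + trA2 p" by simp
  \<comment> \<open>The squared norm of A minus its transpose is 2 |A|^2 - 2 tr A^2.\<close>
  have "0 \<le> (\<Sum>e\<in>E. \<Sum>f\<in>E. (a e f - a f e)\<^sup>2)" by (intro sum_nonneg) auto
  also have "\<dots> = normA2 p + normA2 p - 2 * trA2 p"
    unfolding N' T by (subst (1) N'[symmetric], unfold N)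
      (simp add: power2_diff sum.distrib sum_subtractf sum_distrib_left mult.assoc)
  finally have W: "trA2 p \<le> normA2 p" by simp
  have "(trA p)\<^sup>2 = (\<Sum>e\<in>E. 1 * S e e)\<^sup>2" by (simp add: trA_onb S_def a_def)
  also have "\<dots> \<le> (\<Sum>e\<in>E. 1\<^sup>2) * (\<Sum>e\<in>E. (S e e)\<^sup>2)" by (rule Cauchy_Schwarz_ineq_sum)
  also have "\<dots> = n * (\<Sum>e\<in>E. (S e e)\<^sup>2)" using n by simp
  also have "\<dots> \<le> n * (\<Sum>e\<in>E. \<Sum>f\<in>E. (S e f)\<^sup>2)"
    using n onb_finite[OF E] by (intro mult_left_mono sum_mono member_le_sum) auto
  finally have "2 * (trA p)\<^sup>2 \<le> n * (2 * (\<Sum>e\<in>E. \<Sum>f\<in>E. (S e f)\<^sup>2))" by simp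
  then have "2 * (trA p)\<^sup>2 \<le> n * (normA2 p + trA2 p)" unfolding S .
  \<comment> \<open>The sign of \<open>n - 2\<close> matters here: this is where the sphere must
    have dimension at least 2.\<close>
  moreover have "(n - 2) * trA2 p \<le> (n - 2) * normA2 p"
    using W n by (intro mult_left_mono) auto
  ultimately have "2 * (trA p)\<^sup>2 - 2 * trA2 p \<le> 2 * ((n - 1) * normA2 p)"
    by (simp add: algebra_simps)
  then show ?thesis by (simp add: n_def algebra_simps)
qed

end

lemma nabla_norm2_eq: "p \<in> sphere 0 r \<Longrightarrow> nabla_norm2 X p = normA2 p"
  unfolding nabla_norm2_def Let_def
  by (rule normA2_nabla[symmetric, OF _ orthonormal_basis_of_tangent_space])

text \<open>The divergence theorem for the tangential part of \<open>(tr A) X - D\<^sub>X X\<close>; the second derivatives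
  of \<open>X\<close> cancel by symmetry.\<close>

lemma integral_trA:
  "r\<^sup>2 * sphere_integral r (\<lambda>p. (trA p)\<^sup>2 - trA2 p) =
    (real DIM('a) - 2) * sphere_integral r (\<lambda>p. (norm (X p))\<^sup>2)"
proof -
  define t' where "t' x w = (\<Sum>b\<in>Basis. H x w b \<bullet> b) - (D x x \<bullet> w + (H x w x + D x w) \<bullet> x) / r\<^sup>2" for x w
  define Y where "Y x = trA x *\<^sub>R X x - D x (X x)" for x
  define Y' where "Y' x w = (trA x *\<^sub>R D x w + t' x w *\<^sub>R X x) - (H x w (X x) + D x (D x w))" for x w
  have Dxx: "((\<lambda>y. D y y) has_derivative (\<lambda>w. H x w x + D x w)) (at x)" if x: "x \<in> U" for x
  proof -
    have "((\<lambda>y. \<Sum>b\<in>Basis. (y \<bullet> b) *\<^sub>R D y b) has_derivative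
        (\<lambda>w. \<Sum>b\<in>Basis. (x \<bullet> b) *\<^sub>R H x w b + (w \<bullet> b) *\<^sub>R D x b)) (at x)"
      by (intro has_derivative_sum has_derivative_scaleR has_derivative_H has_derivative_inner_left has_derivative_ident x)
    also have "(\<lambda>w. \<Sum>b\<in>Basis. (x \<bullet> b) *\<^sub>R H x w b + (w \<bullet> b) *\<^sub>R D x b) = (\<lambda>w. H x w x + D x w)"
      unfolding sum.distrib D_expand[OF x, symmetric] H_expand[OF x, symmetric] ..
    finally show ?thesis
      by (rule has_derivative_transform_within_open[OF _ open_U x]) (rule D_expand[symmetric])
  qed
  have t': "(trA has_derivative t' x) (at x)" if "x \<in> U" for x
  proof -
    have 1: "((\<lambda>x. \<Sum>b\<in>Basis. D x b \<bullet> b) has_derivative (\<lambda>w. \<Sum>b\<in>Basis. H x w b \<bullet> b)) (at x)"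
      by (intro has_derivative_sum has_derivative_inner_left has_derivative_H that)
    have 2: "((\<lambda>x. D x x \<bullet> x) has_derivative (\<lambda>w. D x x \<bullet> w + (H x w x + D x w) \<bullet> x)) (at x)"
      by (rule has_derivative_inner[OF Dxx[OF that] has_derivative_ident])
    show ?thesis
      unfolding trA_def[abs_def] t'_def[abs_def] divide_inverse
      by (intro has_derivative_diff 1 has_derivative_mult_left 2)
  qed
  have Y: "(Y has_derivative Y' x) (at x)" if "x \<in> U" for x
    unfolding Y_def[abs_def] Y'_def[abs_def]
    by (intro has_derivative_diff has_derivative_scaleR t' has_derivative_D has_derivative_DX that)
  have cY': "continuous_on (sphere 0 r) (\<lambda>x. Y' x w)" for w
    unfolding Y'_def t'_def using r_pos
    by (intro continuous_intros continuous_on_trA continuous_on_sphere_D continuous_on_sphere_H continuous_on_sphere_X) auto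
  \<comment> \<open>The left side is r^2 times the tangential divergence of \<open>Y\<close>. The
    terms with \<open>H\<close> cancel by \<open>H_sym\<close>, and \<open>|X|^2\<close> arises from
    the normal component of \<open>D p (X p)\<close>.\<close>
  have key: "r\<^sup>2 * (\<Sum>b\<in>Basis. Y' p b \<bullet> b) - Y' p p \<bullet> p = r\<^sup>2 * ((trA p)\<^sup>2 - trA2 p) + (norm (X p))\<^sup>2"
    if p: "p \<in> sphere 0 r" for p
  proof -
    note pU = in_U[OF p]
    have r2: "r\<^sup>2 \<noteq> 0" using r_pos by simp
    have Xp: "X p \<bullet> p = 0" "D p (X p) \<bullet> p = - (norm (X p))\<^sup>2"
      using tangent[OF p] D_normal[OF p tangent[OF p]] by (simp_all add: power2_norm_eq_inner)
    have lt: "linear (t' p)" using t'[OF pU] has_derivative_linear by blast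
    have s1: "(\<Sum>b\<in>Basis. t' p b * (X p \<bullet> b)) = t' p (X p)"
      using linear_sum[OF lt, of "\<lambda>b. (X p \<bullet> b) *\<^sub>R b" Basis]
      by (simp add: linear_cmul[OF lt] euclidean_representation mult.commute)
    have s2: "(\<Sum>b\<in>Basis. H p b (X p) \<bullet> b) = (\<Sum>b\<in>Basis. H p (X p) b \<bullet> b)"
      by (simp add: H_sym[OF pU, of "X p"])
    define h where "h = (\<Sum>b\<in>Basis. H p (X p) b \<bullet> b)"
    have "(\<Sum>b\<in>Basis. Y' p b \<bullet> b) = trA p * (\<Sum>b\<in>Basis. D p b \<bullet> b) + t' p (X p) - h
        - (\<Sum>b\<in>Basis. D p (D p b) \<bullet> b)"
      unfolding Y'_def h_def s1[symmetric] s2[symmetric]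
      by (simp add: inner_simps sum.distrib sum_subtractf sum_distrib_left)
    moreover have "Y' p p \<bullet> p = trA p * (D p p \<bullet> p) - H p (X p) p \<bullet> p - D p (D p p) \<bullet> p"
      unfolding Y'_def by (simp add: inner_simps Xp H_sym[OF pU, of "X p"])
    moreover have "r\<^sup>2 * t' p (X p) = r\<^sup>2 * h - (D p p \<bullet> X p + H p (X p) p \<bullet> p - (norm (X p))\<^sup>2)"
      using r2 by (simp add: t'_def h_def[symmetric] inner_simps Xp right_diff_distrib)
    moreover have "r\<^sup>2 * (\<Sum>b\<in>Basis. D p b \<bullet> b) = r\<^sup>2 * trA p + D p p \<bullet> p"
      using r2 by (simp add: trA_def right_diff_distrib)
    moreover have "r\<^sup>2 * (\<Sum>b\<in>Basis. D p (D p b) \<bullet> b) = r\<^sup>2 * trA2 p + D p (D p p) \<bullet> p - D p p \<bullet> X p"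
      using r2 by (simp add: trA2_def algebra_simps)
    ultimately show ?thesis by algebra
  qed
  \<comment> \<open>The field \<open>Y\<close> is not tangent, so the divergence theorem contributes
    DIM - 1 times the integral of |X|^2; the |X|^2 in \<open>key\<close> lowers the factor to DIM -
    2.\<close>
  have Yp: "Y p \<bullet> p = (norm (X p))\<^sup>2" if p: "p \<in> sphere 0 r" for p
    using tangent[OF p] D_normal[OF p tangent[OF p]] by (simp add: Y_def inner_simps power2_norm_eq_inner)
  have c1: "continuous_on (sphere 0 r) (\<lambda>p. (trA p)\<^sup>2 - trA2 p)"
    by (intro continuous_intros continuous_on_trA continuous_on_trA2)
  have c2: "continuous_on (sphere 0 r) (\<lambda>p. (norm (X p))\<^sup>2)"
    by (intro continuous_intros continuous_on_sphere_X)
  have "sphere_integral r (\<lambda>p. r\<^sup>2 * ((trA p)\<^sup>2 - trA2 p) + (norm (X p))\<^sup>2)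
      = sphere_integral r (\<lambda>x. r\<^sup>2 * (\<Sum>b\<in>Basis. Y' x b \<bullet> b) - Y' x x \<bullet> x)"
    by (rule sphere_integral_cong[OF r_pos]) (use key in \<open>auto intro!: continuous_intros c1 c2\<close>)
  also have "\<dots> = (real DIM('a) - 1) * sphere_integral r (\<lambda>x. Y x \<bullet> x)"
    by (rule sphere_divergence[OF r_pos sphere_U Y cY'])
  also have "sphere_integral r (\<lambda>x. Y x \<bullet> x) = sphere_integral r (\<lambda>p. (norm (X p))\<^sup>2)"
    by (rule sphere_integral_cong[OF r_pos, symmetric]) (use Yp c2 in auto)
  finally show ?thesis
    using sphere_integral_add[OF r_pos, of "\<lambda>p. r\<^sup>2 * ((trA p)\<^sup>2 - trA2 p)", OF _ c2] c1
    by (simp add: sphere_integral_cmult continuous_on_mult_left left_diff_distrib)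
qed

end

subsection \<open>Smoothness of projected constant fields\<close>

lemma Cdiff_has_derivative:
  assumes "open U" "Cdiff (Suc m) U f" "x \<in> U"
  shows "(f has_derivative frechet_derivative f (at x)) (at x)"
proof -
  have "f differentiable at x within U" using assms by (simp add: differentiable_on_def)
  then show ?thesis using assms(3) by (simp add: at_within_open[OF _ assms(1)] frechet_derivative_works)
qed

text \<open>On an open set derivatives are local, so equality on \<open>U\<close> passes to every
  order although \<open>f\<close> and \<open>g\<close> may differ outside \<open>U\<close>.\<close>

lemma Cdiff_cong:
  assumes "open U" "Cdiff m U f" "\<And>x. x \<in> U \<Longrightarrow> f x = g x"
  shows "Cdiff m U g"
  using assms(2,3)
proof (induction m arbitrary: f g)
  case 0
  then show ?case using continuous_on_cong[OF refl, of U f g] by simp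
next
  case (Suc m)
  have d: "(g has_derivative frechet_derivative f (at x)) (at x)" if "x \<in> U" for x
    using has_derivative_transform_within_open[OF Cdiff_has_derivative[OF assms(1) Suc.prems(1) that] assms(1) that]
      Suc.prems(2) by blast
  have "g differentiable_on U"
    using d unfolding differentiable_on_def by (blast intro: differentiableI has_derivative_at_withinI)
  moreover have "Cdiff m U (\<lambda>x. frechet_derivative g (at x) v)" if "v \<in> Basis" for v
    by (rule Suc.IH[of "\<lambda>x. frechet_derivative f (at x) v"])
      (use Suc.prems(1) that in \<open>auto simp: frechet_derivative_at[OF d]\<close>)
  ultimately show ?case by simp
qed

text \<open>Allows an explicit derivative formula in place of \<open>frechet_derivative\<close>,
  which the closure rules below rely on.\<close>

lemma Cdiff_SucI:
  assumes U: "open U" and d: "\<And>x. x \<in> U \<Longrightarrow> (f has_derivative f' x) (at x)"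
    and f': "\<And>v. v \<in> Basis \<Longrightarrow> Cdiff m U (\<lambda>x. f' x v)"
  shows "Cdiff (Suc m) U f"
proof -
  have "f differentiable_on U"
    using d unfolding differentiable_on_def by (blast intro: differentiableI has_derivative_at_withinI)
  moreover have "Cdiff m U (\<lambda>x. frechet_derivative f (at x) v)" if "v \<in> Basis" for v
    by (rule Cdiff_cong[OF U f'[OF that]]) (simp add: frechet_derivative_at[OF d])
  ultimately show ?thesis by simp
qed

text \<open>Needed for the product rule, where a factor that is not differentiated is used at the
  lower order.\<close>

lemma Cdiff_SucD:
  assumes "open U" "Cdiff (Suc m) U f"
  shows "Cdiff m U f"
  using assms(2)
proof (induction m arbitrary: f)
  case 0
  then show ?case by (simp add: differentiable_imp_continuous_on)
next
  case (Suc m)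
  have "f differentiable_on U \<and> (\<forall>v\<in>Basis. Cdiff (Suc m) U (\<lambda>x. frechet_derivative f (at x) v))"
    using Suc.prems unfolding Cdiff.simps(2)[of "Suc m"] .
  with Suc.IH show ?case unfolding Cdiff.simps(2)[of m] by blast
qed

lemma Cdiff_const: "open U \<Longrightarrow> Cdiff m U (\<lambda>x. c)"
  by (induction m arbitrary: c) (auto intro!: continuous_intros Cdiff_SucI[where f'="\<lambda>_ _. 0"] simp del: Cdiff.simps(2))

lemma Cdiff_linear:
  assumes "open U" "bounded_linear f"
  shows "Cdiff m U f"
proof (cases m)
  case 0
  then show ?thesis using assms by (simp add: linear_continuous_on)
next
  case (Suc n)
  show ?thesis unfolding Suc
    by (rule Cdiff_SucI[OF assms(1) bounded_linear_imp_has_derivative[OF assms(2)] Cdiff_const[OF assms(1)]])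
qed

lemma Cdiff_add:
  assumes "open U" "Cdiff m U f" "Cdiff m U g"
  shows "Cdiff m U (\<lambda>x. f x + g x)"
  using assms(2,3)
proof (induction m arbitrary: f g)
  case 0
  then show ?case by (simp add: continuous_on_add)
next
  case (Suc m)
  show ?case
  proof (rule Cdiff_SucI[OF assms(1)])
    show "((\<lambda>x. f x + g x) has_derivative (\<lambda>v. frechet_derivative f (at x) v + frechet_derivative g (at x) v)) (at x)"
      if "x \<in> U" for x
      by (intro has_derivative_add Cdiff_has_derivative[OF assms(1) Suc.prems(1)]
          Cdiff_has_derivative[OF assms(1) Suc.prems(2)] that)
  qed (use Suc in simp)
qed

lemma Cdiff_scaleR:
  fixes f :: "'a::euclidean_space \<Rightarrow> 'b::euclidean_space" and g :: "'a \<Rightarrow> real"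
  assumes "open U" "Cdiff m U g" "Cdiff m U f"
  shows "Cdiff m U (\<lambda>x. g x *\<^sub>R f x)"
  using assms(2,3)
proof (induction m arbitrary: f g)
  case 0
  then show ?case by (simp add: continuous_on_scaleR)
next
  case (Suc m)
  show ?case
  proof (rule Cdiff_SucI[OF assms(1)])
    show "((\<lambda>x. g x *\<^sub>R f x) has_derivative
        (\<lambda>v. g x *\<^sub>R frechet_derivative f (at x) v + frechet_derivative g (at x) v *\<^sub>R f x)) (at x)"
      if "x \<in> U" for x
      by (intro has_derivative_scaleR Cdiff_has_derivative[OF assms(1) Suc.prems(1)]
          Cdiff_has_derivative[OF assms(1) Suc.prems(2)] that)
    show "Cdiff m U (\<lambda>x. g x *\<^sub>R frechet_derivative f (at x) v + frechet_derivative g (at x) v *\<^sub>R f x)"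
      if "v \<in> Basis" for v
      by (intro Cdiff_add[OF assms(1)] Suc.IH) (use Suc.prems that Cdiff_SucD[OF assms(1)] in auto)
  qed
qed

text \<open>The derivative of 1/g involves 1/g again, but only one order lower, so induction closes;
  it is written with \<open>*\<^sub>R\<close> throughout to match
  \<open>Cdiff_scaleR\<close>.\<close>

lemma Cdiff_inverse:
  fixes g :: "'a::euclidean_space \<Rightarrow> real"
  assumes U: "open U" and nz: "\<And>x. x \<in> U \<Longrightarrow> g x \<noteq> 0" and "Cdiff m U g"
  shows "Cdiff m U (\<lambda>x. inverse (g x))"
  using assms(3)
proof (induction m)
  case 0
  then show ?case using nz by (simp add: continuous_on_inverse)
next
  case (Suc m)
  have i: "Cdiff m U (\<lambda>x. inverse (g x))" using Suc Cdiff_SucD[OF U] by blast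
  show ?case
  proof (rule Cdiff_SucI[OF U])
    show "((\<lambda>x. inverse (g x)) has_derivative
        (\<lambda>v. (-1) *\<^sub>R (inverse (g x) *\<^sub>R inverse (g x) *\<^sub>R frechet_derivative g (at x) v))) (at x)"
      if "x \<in> U" for x
      using Deriv.has_derivative_inverse[OF nz[OF that] Cdiff_has_derivative[OF U Suc.prems that]]
      by (simp add: mult_ac)
    show "Cdiff m U (\<lambda>x. (-1) *\<^sub>R (inverse (g x) *\<^sub>R inverse (g x) *\<^sub>R frechet_derivative g (at x) v))"
      if "v \<in> Basis" for v
      by (intro Cdiff_scaleR[OF U] Cdiff_const[OF U] i) (use Suc.prems that in auto)
  qed
qed

lemma smooth_on_tproj: "smooth_on (- {0}) (\<lambda>p::'a::euclidean_space. tproj p c)"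
  unfolding smooth_on_def
proof
  fix m
  have U: "open (- {0::'a})" by auto
  have "Cdiff m (- {0}) (\<lambda>p::'a. p \<bullet> p)"
  proof (cases m)
    case 0
    then show ?thesis by (auto intro!: continuous_intros)
  next
    case (Suc n)
    show ?thesis unfolding Suc
    proof (rule Cdiff_SucI[OF U])
      show "((\<lambda>p::'a. p \<bullet> p) has_derivative (\<lambda>v. x \<bullet> v + v \<bullet> x)) (at x)" for x
        by (auto intro!: derivative_eq_intros)
      show "Cdiff n (- {0}) (\<lambda>x::'a. x \<bullet> v + v \<bullet> x)" for v
        by (intro Cdiff_linear[OF U] bounded_linear_intros)
    qed
  qed
  then have "Cdiff m (- {0}) (\<lambda>p::'a. inverse (p \<bullet> p))"
    by (rule Cdiff_inverse[OF U, rotated]) simp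
  then have "Cdiff m (- {0}) (\<lambda>p::'a. (c \<bullet> p) *\<^sub>R inverse (p \<bullet> p))"
    by (intro Cdiff_scaleR[OF U Cdiff_linear[OF U]] bounded_linear_inner_right)
  \<comment> \<open>The projection is rewritten without difference or quotient, in the operations
    covered by the closure rules.\<close>
  then have "Cdiff m (- {0}) (\<lambda>p::'a. c + (-1) *\<^sub>R (((c \<bullet> p) *\<^sub>R inverse (p \<bullet> p)) *\<^sub>R p))"
    by (intro Cdiff_add[OF U Cdiff_const[OF U]] Cdiff_scaleR[OF U Cdiff_const[OF U]]
        Cdiff_scaleR[OF U _ Cdiff_linear[OF U bounded_linear_ident]])
  then show "Cdiff m (- {0}) (\<lambda>p::'a. tproj p c)"
    by (simp add: tproj_def divide_inverse)
qed

lemma smooth_tangent_field_tproj: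
  assumes "r > 0"
  shows "smooth_tangent_field r (\<lambda>p. tproj p c)"
  unfolding smooth_tangent_field_def
proof
  show "\<exists>U. open U \<and> sphere 0 r \<subseteq> U \<and> smooth_on U (\<lambda>p. tproj p c)"
    using assms smooth_on_tproj by (intro exI[of _ "- {0}"]) auto
  show "\<forall>p\<in>sphere 0 r. tproj p c \<in> tangent_space p"
    using assms by (auto intro!: tproj_in_tangent_space)
qed

lemma smooth_tangent_fieldE:
  assumes "smooth_tangent_field r X" "r > 0"
  obtains U where "tangent_field U X r"
proof -
  from assms obtain U where U: "open U" "sphere 0 r \<subseteq> U" "smooth_on U X"
    "\<And>p. p \<in> sphere 0 r \<Longrightarrow> X p \<bullet> p = 0"
    unfolding smooth_tangent_field_def tangent_space_def by blast
  have "tangent_field U X r" by unfold_locales (use U assms in auto)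
  then show ?thesis by (rule that)
qed

subsection \<open>The Rayleigh quotient\<close>

context tangent_field
begin

lemma integral_norm_pos:
  assumes "\<exists>p\<in>sphere 0 r. X p \<noteq> 0"
  shows "sphere_integral r (\<lambda>p. (norm (X p))\<^sup>2) > 0"
proof -
  obtain p where "p \<in> sphere 0 r" "X p \<noteq> 0" using assms by blast
  then show ?thesis
    by (intro sphere_integral_pos[OF r_pos, of _ p] continuous_intros continuous_on_sphere_X) auto
qed

lemma rayleigh_eq:
  "rayleigh r X = sphere_integral r normA2 / sphere_integral r (\<lambda>p. (norm (X p))\<^sup>2)"
proof -
  have "sphere_integral r (nabla_norm2 X) = sphere_integral r normA2"
    by (rule sphere_integral_cong[OF r_pos continuous_on_normA2, symmetric]) (simp add: nabla_norm2_eq)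
  then show ?thesis by (simp add: rayleigh_def)
qed

text \<open>Integrating \<open>trA_le\<close> and inserting \<open>integral_trA\<close> leaves the
  same positive factor DIM - 2 on both sides.\<close>

lemma rayleigh_ge:
  assumes "DIM('a) \<ge> 3" "\<exists>p\<in>sphere 0 r. X p \<noteq> 0"
  shows "rayleigh r X \<ge> (1 / r)\<^sup>2"
proof -
  let ?I = "sphere_integral r (\<lambda>p. (norm (X p))\<^sup>2)"
  have d: "real DIM('a) - 2 > 0" using assms(1) by simp
  have "sphere_integral r (\<lambda>p. (trA p)\<^sup>2 - trA2 p) \<le> sphere_integral r (\<lambda>p. (real DIM('a) - 2) * normA2 p)"
    using trA_le[OF _ orthonormal_basis_of_tangent_space assms(1)]
    by (intro sphere_integral_mono[OF r_pos] continuous_intros continuous_on_trA continuous_on_trA2 continuous_on_normA2)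
  then have "r\<^sup>2 * sphere_integral r (\<lambda>p. (trA p)\<^sup>2 - trA2 p)
      \<le> r\<^sup>2 * ((real DIM('a) - 2) * sphere_integral r normA2)"
    by (intro mult_left_mono) (simp_all add: sphere_integral_cmult)
  then have "(real DIM('a) - 2) * ?I \<le> (real DIM('a) - 2) * (r\<^sup>2 * sphere_integral r normA2)"
    unfolding integral_trA by (simp add: mult.left_commute)
  then have "?I \<le> r\<^sup>2 * sphere_integral r normA2"
    using d by simp
  then show ?thesis using integral_norm_pos[OF assms(2)] r_pos
    by (simp add: rayleigh_eq field_simps)
qed

text \<open>The equality case of the method: a pointwise proportionality turns
  \<open>integral_trA\<close> into the value of the quotient. It serves projected constant fields
  with \<open>c\<close> = DIM - 2 and Killing fields with \<open>c\<close> = 1.\<close>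

lemma rayleigh_proportional:
  assumes ne: "\<exists>p\<in>sphere 0 r. X p \<noteq> 0"
    and c: "\<And>p. p \<in> sphere 0 r \<Longrightarrow> (trA p)\<^sup>2 - trA2 p = c * normA2 p"
  shows "c * rayleigh r X = (real DIM('a) - 2) * (1 / r)\<^sup>2"
proof -
  let ?I = "sphere_integral r (\<lambda>p. (norm (X p))\<^sup>2)"
  have "sphere_integral r (\<lambda>p. (trA p)\<^sup>2 - trA2 p) = sphere_integral r (\<lambda>p. c * normA2 p)"
    by (rule sphere_integral_cong[OF r_pos])
      (auto simp: c intro!: continuous_intros continuous_on_trA continuous_on_trA2)
  then have "r\<^sup>2 * (c * sphere_integral r normA2) = (real DIM('a) - 2) * ?I"
    using integral_trA by (simp add: sphere_integral_cmult)
  then show ?thesis using integral_norm_pos[OF ne] r_pos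
    by (simp add: rayleigh_eq field_simps)
qed

text \<open>Here A is \<open>l p\<close> times the identity of an n-dimensional space, so (tr A)^2 =
  n^2 l^2 and tr A^2 = |A|^2 = n l^2; their difference is (n - 1) |A|^2.\<close>

lemma rayleigh_conformal:
  assumes "DIM('a) \<ge> 3" "\<exists>p\<in>sphere 0 r. X p \<noteq> 0"
    and l: "\<And>p v w. p \<in> sphere 0 r \<Longrightarrow> v \<bullet> p = 0 \<Longrightarrow> w \<bullet> p = 0 \<Longrightarrow> D p v \<bullet> w = l p * (v \<bullet> w)"
  shows "rayleigh r X = (1 / r)\<^sup>2"
proof -
  have "(trA p)\<^sup>2 - trA2 p = (real DIM('a) - 2) * normA2 p" if p: "p \<in> sphere 0 r" for p
  proof -
    define E where "E = (SOME B. orthonormal_basis_of B (tangent_space p))"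
    have E: "orthonormal_basis_of E (tangent_space p)"
      unfolding E_def by (rule orthonormal_basis_of_tangent_space)
    have a: "D p e \<bullet> f = (if e = f then l p else 0)" if "e \<in> E" "f \<in> E" for e f
      using l[OF p onb_tangent[OF E that(1)] onb_tangent[OF E that(2)]] onb_inner[OF E that] by simp
    have "trA p = (\<Sum>e\<in>E. l p)" unfolding trA_onb[OF p E] by (intro sum.cong refl) (simp add: a)
    moreover have "trA2 p = (\<Sum>e\<in>E. \<Sum>f\<in>E. if e = f then (l p)\<^sup>2 else 0)"
      unfolding trA2_onb[OF p E] by (intro sum.cong refl) (auto simp: a power2_eq_square)
    moreover have "normA2 p = (\<Sum>e\<in>E. \<Sum>f\<in>E. if e = f then (l p)\<^sup>2 else 0)"
      unfolding normA2_onb[OF p E] by (intro sum.cong refl) (auto simp: a power2_eq_square)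
    ultimately show ?thesis using onb_finite[OF E]
      by (simp add: card_onb[OF E sphere_nonzero[OF p]] power_mult_distrib) (simp add: algebra_simps power2_eq_square)
  qed
  from rayleigh_proportional[OF assms(2) this] assms(1) show ?thesis by simp
qed

text \<open>Skewness of A gives tr A = 0 and tr A^2 = -|A|^2.\<close>

lemma rayleigh_killing:
  assumes "killing_field r X" "\<exists>p\<in>sphere 0 r. X p \<noteq> 0"
  shows "rayleigh r X = (real DIM('a) - 2) * (1 / r)\<^sup>2"
proof -
  have "(trA p)\<^sup>2 - trA2 p = 1 * normA2 p" if p: "p \<in> sphere 0 r" for p
  proof -
    define E where "E = (SOME B. orthonormal_basis_of B (tangent_space p))"
    have E: "orthonormal_basis_of E (tangent_space p)"
      unfolding E_def by (rule orthonormal_basis_of_tangent_space)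
    have a: "D p f \<bullet> e = - (D p e \<bullet> f)" if "e \<in> E" "f \<in> E" for e f
    proof -
      have "nabla X p e \<bullet> f + nabla X p f \<bullet> e = 0"
        using assms(1) p onb_tangent[OF E] that unfolding killing_field_def tangent_space_def by blast
      then show ?thesis
        using nabla_inner[OF onb_tangent[OF E that(1)]] nabla_inner[OF onb_tangent[OF E that(2)]] by simp
    qed
    have "D p e \<bullet> e = 0" if "e \<in> E" for e using a[OF that that] by simp
    then have "trA p = 0" unfolding trA_onb[OF p E] by simp
    moreover have "trA2 p = (\<Sum>e\<in>E. \<Sum>f\<in>E. - (D p e \<bullet> f)\<^sup>2)"
      unfolding trA2_onb[OF p E]
    proof (intro sum.cong refl)
      fix e f assume "e \<in> E" "f \<in> E"
      then show "(D p e \<bullet> f) * (D p f \<bullet> e) = - (D p e \<bullet> f)\<^sup>2"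
        by (simp only: a[of e f] power2_eq_square mult_minus_right)
    qed
    ultimately show ?thesis unfolding normA2_onb[OF p E] by (simp add: sum_negf)
  qed
  from rayleigh_proportional[OF assms(2) this] show ?thesis by simp
qed

end

section \<open>Projected constant fields as minimisers\<close>

text \<open>At a point of the sphere orthogonal to \<open>c\<close> the projection leaves
  \<open>c\<close> unchanged; such a point exists from dimension 2 on.\<close>

lemma tproj_nonzero:
  fixes c :: "'a::euclidean_space"
  assumes "DIM('a) \<ge> 2" "r > 0" "c \<noteq> 0"
  shows "\<exists>p\<in>sphere 0 r. tproj p c \<noteq> 0"
proof -
  obtain y where y: "y \<noteq> 0" "orthogonal c y"
    using orthogonal_to_vector_exists[OF assms(1)] by blast
  have "tproj ((r / norm y) *\<^sub>R y) c = c"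
    using y by (simp add: tproj_def orthogonal_def)
  moreover have "(r / norm y) *\<^sub>R y \<in> sphere 0 r" using y assms(2) by simp
  ultimately show ?thesis using assms(3) by metis
qed

lemma rayleigh_tproj:
  fixes c :: "'a::euclidean_space"
  assumes "DIM('a) \<ge> 3" "r > 0" "c \<noteq> 0"
  shows "rayleigh r (\<lambda>p. tproj p c) = (1 / r)\<^sup>2"
proof -
  obtain U where "tangent_field U (\<lambda>p. tproj p c) r"
    using smooth_tangent_fieldE[OF smooth_tangent_field_tproj[OF assms(2)] assms(2)] .
  then interpret tangent_field U "\<lambda>p. tproj p c" r .
  show ?thesis
  proof (rule rayleigh_conformal[OF assms(1) tproj_nonzero])
    fix p v w :: 'a assume p: "p \<in> sphere 0 r" "v \<bullet> p = 0" "w \<bullet> p = 0"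
    have nz: "p \<bullet> p \<noteq> 0" using sphere_nonzero[OF p(1)] by simp
    \<comment> \<open>The derivative of \<open>(c \<bullet> x) / (x \<bullet> x)\<close> at
      \<open>p\<close>. It multiplies the normal vector \<open>p\<close> and so disappears against a
      tangent \<open>w\<close>, leaving the conformal factor
      \<open>- (c \<bullet> p) / (p \<bullet> p)\<close>.\<close>
    define g' where "g' v = ((c \<bullet> v) * (p \<bullet> p) - (c \<bullet> p) * (p \<bullet> v + v \<bullet> p)) / ((p \<bullet> p) * (p \<bullet> p))" for v
    have "((\<lambda>x. tproj x c) has_derivative (\<lambda>v. - (((c \<bullet> p) / (p \<bullet> p)) *\<^sub>R v + g' v *\<^sub>R p))) (at p)"
      unfolding tproj_def g'_def using nz
      by (auto intro!: derivative_eq_intros simp: divide_simps) 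
    from fun_cong[OF has_derivative_unique[OF has_derivative_D[OF in_U[OF p(1)]] this]]
    show "D p v \<bullet> w = - ((c \<bullet> p) / (p \<bullet> p)) * (v \<bullet> w)"
      using p(3) by (simp add: inner_commute[of p w] inner_diff_left)
  qed (use assms in auto)
qed

theorem theorem3p1:
  fixes k :: real
  assumes "DIM('a::euclidean_space) \<ge> 3"
    and "k > 0"
  shows "((INF X\<in>{X :: 'a \<Rightarrow> 'a. smooth_tangent_field (1/k) X \<and> (\<exists>p\<in>sphere 0 (1/k). X p \<noteq> 0)}.
            rayleigh (1/k) X) = k\<^sup>2)
       \<and> (\<forall>c::'a. c \<noteq> 0 \<longrightarrow>
            smooth_tangent_field (1/k) (\<lambda>p. tproj p c) \<and>
            (\<exists>p\<in>sphere 0 (1/k). tproj p c \<noteq> 0) \<and>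
            rayleigh (1/k) (\<lambda>p. tproj p c) = k\<^sup>2)
       \<and> (\<forall>X :: 'a \<Rightarrow> 'a. killing_field (1/k) X \<and> (\<exists>p\<in>sphere 0 (1/k). X p \<noteq> 0) \<longrightarrow>
            (rayleigh (1/k) X = k\<^sup>2 \<longleftrightarrow> DIM('a) = 3))"
proof -
  have r: "1 / k > 0" "(1 / (1 / k))\<^sup>2 = k\<^sup>2" using assms(2) by auto
  have attained: "smooth_tangent_field (1/k) (\<lambda>p. tproj p c) \<and>
      (\<exists>p\<in>sphere 0 (1/k). tproj p c \<noteq> 0) \<and> rayleigh (1/k) (\<lambda>p. tproj p c) = k\<^sup>2"
    if "c \<noteq> 0" for c :: 'a
    using smooth_tangent_field_tproj[OF r(1)] tproj_nonzero[OF _ r(1) that]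
      rayleigh_tproj[OF assms(1) r(1) that] assms(1) r(2) by auto
  have lower: "k\<^sup>2 \<le> rayleigh (1/k) X"
    if X: "smooth_tangent_field (1/k) X" "\<exists>p\<in>sphere 0 (1/k). X p \<noteq> 0" for X :: "'a \<Rightarrow> 'a"
  proof -
    obtain U where "tangent_field U X (1/k)" using smooth_tangent_fieldE[OF X(1) r(1)] .
    from tangent_field.rayleigh_ge[OF this assms(1) X(2)] show ?thesis unfolding r(2) .
  qed
  obtain c :: 'a where c: "c \<noteq> 0" using SOME_Basis nonzero_Basis by blast
  have "(INF X\<in>{X :: 'a \<Rightarrow> 'a. smooth_tangent_field (1/k) X \<and> (\<exists>p\<in>sphere 0 (1/k). X p \<noteq> 0)}.
      rayleigh (1/k) X) = k\<^sup>2"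
  \<comment> \<open>Since the lower bound is attained, the infimum is a minimum; this settles
    nonemptiness and boundedness as well.\<close>
  proof (rule cInf_eq_minimum)
    show "k\<^sup>2 \<in> rayleigh (1/k) ` {X :: 'a \<Rightarrow> 'a. smooth_tangent_field (1/k) X \<and> (\<exists>p\<in>sphere 0 (1/k). X p \<noteq> 0)}"
      using attained[OF c] by (intro image_eqI[of _ _ "\<lambda>p. tproj p c"]) auto
  qed (use lower in auto)
  moreover have "rayleigh (1/k) X = k\<^sup>2 \<longleftrightarrow> DIM('a) = 3"
    if X: "killing_field (1/k) X" "\<exists>p\<in>sphere 0 (1/k). X p \<noteq> 0" for X :: "'a \<Rightarrow> 'a"
  proof -
    obtain U where "tangent_field U X (1/k)"
      using X(1) smooth_tangent_fieldE[OF _ r(1)] unfolding killing_field_def by blast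
    from tangent_field.rayleigh_killing[OF this X]
    have "rayleigh (1/k) X = (real DIM('a) - 2) * k\<^sup>2" unfolding r(2) .
    \<comment> \<open>The positive factor \<open>k\<^sup>2\<close> cancels; the remaining factor DIM
      - 2 is n - 1, equal to 1 exactly on the 2-sphere.\<close>
    then have "rayleigh (1/k) X = k\<^sup>2 \<longleftrightarrow> real DIM('a) - 2 = 1"
      using assms(2) by auto
    also have "\<dots> \<longleftrightarrow> DIM('a) = 3" by linarith
    finally show ?thesis .
  qed
  ultimately show ?thesis using attained by blast
qed

end
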